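(* Suppose that $R$ is a Gorenstein ring of dimension one. Let $\rho:\mathcal X_R\to\mathcal Y_R$, $\rho(I)=I:I$, and $\eta:\mathcal Y_R\to\mathcal X_R$, $\eta(A)=R:A$. Then $\eta\circ\rho=1_{\mathcal X_R}$ and $\rho\circ\eta=1_{\mathcal Y_R}$, so that $\rho:\mathcal X_R\to\mathcal Y_R$ is bijective.
   Context: Rings are commutative; Gorenstein rings are Noetherian. Let $W$ be the set of non-zerodivisors of $R$ and $\mathrm Q(R)=W^{-1}R$ the total ring of fractions. For $R$-submodules $X,Y$ of $\mathrm Q(R)$, $X:Y=\{a\in \mathrm Q(R)\mid aY\subseteq X\}$. An ideal $I$ is regular if $I\cap W\neq\emptyset$. For an $R$-module $M$, $\tau_R(M)$ is the ideal of $R$ generated by all $f(m)$ with $f\in\operatorname{Hom}_R(M,R)$, $m\in M$; an ideal is a trace ideal in $R$ if it equals $\tau_R(M)$ for some $R$-module $M$. $\mathcal X_R$ is the set of regular trace ideals in $R$, and $\mathcal Y_R=\{A\mid A\text{ is a subring of }\mathrm Q(R),\ R\subseteq A,\ aA\subseteq R\text{ for some }a\in W\}$. The maps $\rho$ and $\eta$ are well defined. *)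

theory Defs
  imports "HOL-Algebra.Ring_Divisibility" "HOL-Algebra.Subrings" "HOL-Algebra.Module" "HOL-Library.Extended_Nat"
begin

section \<open>Localization\<close>

text \<open>
  The fraction \<open>r / s\<close> is the class of \<open>(r, s)\<close> under
  \<open>(r, s) \<sim> (r', s') \<longleftrightarrow> (\<exists>t \<in> S. t (s' r) = t (s r'))\<close>.  Sums and products of classes are
  formed as unions over all representatives; as the operations respect \<open>\<sim>\<close>, every member of such
  a union is the same class (see \<open>localization_add\<close> and \<open>localization_mult\<close>).
\<close>

definition fraction :: "('a, 'x) ring_scheme \<Rightarrow> 'a set \<Rightarrow> 'a \<Rightarrow> 'a \<Rightarrow> ('a \<times> 'a) set" where
  "fraction R S r s =
     {(r', s'). r' \<in> carrier R \<and> s' \<in> S \<and>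
        (\<exists>t\<in>S. t \<otimes>\<^bsub>R\<^esub> (s' \<otimes>\<^bsub>R\<^esub> r) = t \<otimes>\<^bsub>R\<^esub> (s \<otimes>\<^bsub>R\<^esub> r'))}"

definition localization :: "('a, 'x) ring_scheme \<Rightarrow> 'a set \<Rightarrow> ('a \<times> 'a) set ring" where
  "localization R S =
     \<lparr>carrier = {fraction R S r s | r s. r \<in> carrier R \<and> s \<in> S},
      monoid.mult = (\<lambda>p q. \<Union>((r, s), (r', s'))\<in>p \<times> q.
                fraction R S (r \<otimes>\<^bsub>R\<^esub> r') (s \<otimes>\<^bsub>R\<^esub> s')),
      one = fraction R S \<one>\<^bsub>R\<^esub> \<one>\<^bsub>R\<^esub>,
      zero = fraction R S \<zero>\<^bsub>R\<^esub> \<one>\<^bsub>R\<^esub>,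
      add = (\<lambda>p q. \<Union>((r, s), (r', s'))\<in>p \<times> q.
                fraction R S ((s' \<otimes>\<^bsub>R\<^esub> r) \<oplus>\<^bsub>R\<^esub> (s \<otimes>\<^bsub>R\<^esub> r')) (s \<otimes>\<^bsub>R\<^esub> s'))\<rparr>"

context
  fixes R :: "('a, 'x) ring_scheme" (structure) and S
  assumes R: "cring R" and S: "submonoid S R"
begin

interpretation cring R by (rule R)

lemma mult_set_simps:
  "s \<in> S \<Longrightarrow> s \<in> carrier R" "\<one> \<in> S" "s \<in> S \<Longrightarrow> t \<in> S \<Longrightarrow> s \<otimes> t \<in> S"
  using submonoid.subset[OF S] submonoid.one_closed[OF S] submonoid.m_closed[OF S] by blast+

lemma fraction_self: "r \<in> carrier R \<Longrightarrow> s \<in> S \<Longrightarrow> (r, s) \<in> fraction R S r s"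
  unfolding fraction_def using mult_set_simps(2) by auto

lemma fraction_sym_trans:
  assumes "r1 \<in> carrier R" "r2 \<in> carrier R" "r3 \<in> carrier R" "s1 \<in> S" "s2 \<in> S" "s3 \<in> S"
    and t: "t \<in> S" "t \<otimes> (s2 \<otimes> r1) = t \<otimes> (s1 \<otimes> r2)"
    and u: "u \<in> S" "u \<otimes> (s3 \<otimes> r2) = u \<otimes> (s2 \<otimes> r3)"
  shows "(t \<otimes> u \<otimes> s2) \<otimes> (s3 \<otimes> r1) = (t \<otimes> u \<otimes> s2) \<otimes> (s1 \<otimes> r3)"
proof -
  note c = mult_set_simps(1)[OF assms(4)] mult_set_simps(1)[OF assms(5)]
    mult_set_simps(1)[OF assms(6)] mult_set_simps(1)[OF t(1)] mult_set_simps(1)[OF u(1)] assms(1-3)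
  have "(t \<otimes> u \<otimes> s2) \<otimes> (s3 \<otimes> r1) = u \<otimes> s3 \<otimes> (t \<otimes> (s2 \<otimes> r1))"
    using c by algebra
  also have "\<dots> = t \<otimes> s1 \<otimes> (u \<otimes> (s3 \<otimes> r2))"
    unfolding t(2) using c by algebra
  also have "\<dots> = (t \<otimes> u \<otimes> s2) \<otimes> (s1 \<otimes> r3)"
    unfolding u(2) using c by algebra
  finally show ?thesis .
qed

lemma fraction_eq_iff:
  assumes "r \<in> carrier R" "r' \<in> carrier R" "s \<in> S" "s' \<in> S"
  shows "fraction R S r s = fraction R S r' s' \<longleftrightarrow>
    (\<exists>t\<in>S. t \<otimes> (s' \<otimes> r) = t \<otimes> (s \<otimes> r'))" (is "?L \<longleftrightarrow> ?E")
proof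
  assume ?L
  with fraction_self[OF assms(2,4)] have "(r', s') \<in> fraction R S r s" by simp
  then show ?E by (simp add: fraction_def)
next
  have *: "fraction R S b q \<subseteq> fraction R S a p"
    if "a \<in> carrier R" "b \<in> carrier R" "p \<in> S" "q \<in> S"
      "t \<in> S" "t \<otimes> (q \<otimes> a) = t \<otimes> (p \<otimes> b)" for a b p q t
  proof (clarify)
    fix c x assume "(c, x) \<in> fraction R S b q"
    then obtain u where u: "c \<in> carrier R" "x \<in> S" "u \<in> S" "u \<otimes> (x \<otimes> b) = u \<otimes> (q \<otimes> c)"
      unfolding fraction_def by auto
    have "(t \<otimes> u \<otimes> q) \<otimes> (x \<otimes> a) = (t \<otimes> u \<otimes> q) \<otimes> (p \<otimes> c)"
      using fraction_sym_trans[of a b c p q x t u] that u by blast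
    moreover have "t \<otimes> u \<otimes> q \<in> S" using that u mult_set_simps(3) by blast
    ultimately show "(c, x) \<in> fraction R S a p" unfolding fraction_def using u by blast
  qed
  assume ?E
  then obtain t where t: "t \<in> S" "t \<otimes> (s' \<otimes> r) = t \<otimes> (s \<otimes> r')" by blast
  show ?L
    using *[OF assms t] *[OF assms(2,1,4,3) t(1) t(2)[symmetric]] by blast
qed

lemma fraction_mem:
  assumes "r \<in> carrier R" "s \<in> S" "(r', s') \<in> fraction R S r s"
  shows "r' \<in> carrier R" "s' \<in> S" "fraction R S r' s' = fraction R S r s"
proof -
  show c: "r' \<in> carrier R" "s' \<in> S" using assms(3) unfolding fraction_def by auto
  obtain t where "t \<in> S" "t \<otimes> (s' \<otimes> r) = t \<otimes> (s \<otimes> r')"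
    using assms(3) unfolding fraction_def by auto
  then show "fraction R S r' s' = fraction R S r s"
    using fraction_eq_iff[OF assms(1) c(1) assms(2) c(2)] by auto
qed

lemma localization_mult:
  assumes "a \<in> carrier R" "b \<in> carrier R" "s \<in> S" "t \<in> S"
  shows "fraction R S a s \<otimes>\<^bsub>localization R S\<^esub> fraction R S b t =
    fraction R S (a \<otimes> b) (s \<otimes> t)"
proof -
  have eq: "fraction R S (r1 \<otimes> r2) (s1 \<otimes> s2) = fraction R S (a \<otimes> b) (s \<otimes> t)"
    if h: "(r1, s1) \<in> fraction R S a s" "(r2, s2) \<in> fraction R S b t" for r1 s1 r2 s2
  proof -
    obtain u v where u: "r1 \<in> carrier R" "s1 \<in> S" "u \<in> S" "u \<otimes> (s1 \<otimes> a) = u \<otimes> (s \<otimes> r1)"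
      and v: "r2 \<in> carrier R" "s2 \<in> S" "v \<in> S" "v \<otimes> (s2 \<otimes> b) = v \<otimes> (t \<otimes> r2)"
      using h unfolding fraction_def by auto
    note c = assms u(1) v(1) mult_set_simps(1)[OF assms(3)] mult_set_simps(1)[OF assms(4)]
      mult_set_simps(1)[OF u(2)] mult_set_simps(1)[OF u(3)]
      mult_set_simps(1)[OF v(2)] mult_set_simps(1)[OF v(3)]
    have "(u \<otimes> v) \<otimes> ((s \<otimes> t) \<otimes> (r1 \<otimes> r2)) = (u \<otimes> (s \<otimes> r1)) \<otimes> (v \<otimes> (t \<otimes> r2))"
      using c by algebra
    also have "\<dots> = (u \<otimes> v) \<otimes> ((s1 \<otimes> s2) \<otimes> (a \<otimes> b))"
      unfolding u(4)[symmetric] v(4)[symmetric] using c by algebra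
    finally show ?thesis
      by (subst fraction_eq_iff) (use assms u v mult_set_simps in auto)
  qed
  have "(a, s) \<in> fraction R S a s" "(b, t) \<in> fraction R S b t"
    using fraction_self assms by auto
  then show ?thesis
    unfolding localization_def monoid.simps ring.simps
    by (intro SUP_eq_const) (auto dest: eq)
qed

lemma localization_add:
  assumes "a \<in> carrier R" "b \<in> carrier R" "s \<in> S" "t \<in> S"
  shows "fraction R S a s \<oplus>\<^bsub>localization R S\<^esub> fraction R S b t =
    fraction R S (t \<otimes> a \<oplus> s \<otimes> b) (s \<otimes> t)"
proof -
  have eq: "fraction R S (s2 \<otimes> r1 \<oplus> s1 \<otimes> r2) (s1 \<otimes> s2) = fraction R S (t \<otimes> a \<oplus> s \<otimes> b) (s \<otimes> t)"
    if h: "(r1, s1) \<in> fraction R S a s" "(r2, s2) \<in> fraction R S b t" for r1 s1 r2 s2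
  proof -
    obtain u v where u: "r1 \<in> carrier R" "s1 \<in> S" "u \<in> S" "u \<otimes> (s1 \<otimes> a) = u \<otimes> (s \<otimes> r1)"
      and v: "r2 \<in> carrier R" "s2 \<in> S" "v \<in> S" "v \<otimes> (s2 \<otimes> b) = v \<otimes> (t \<otimes> r2)"
      using h unfolding fraction_def by auto
    note c = assms u(1) v(1) mult_set_simps(1)[OF assms(3)] mult_set_simps(1)[OF assms(4)]
      mult_set_simps(1)[OF u(2)] mult_set_simps(1)[OF u(3)]
      mult_set_simps(1)[OF v(2)] mult_set_simps(1)[OF v(3)]
    have "(u \<otimes> v) \<otimes> ((s \<otimes> t) \<otimes> (s2 \<otimes> r1 \<oplus> s1 \<otimes> r2))
        = v \<otimes> t \<otimes> s2 \<otimes> (u \<otimes> (s \<otimes> r1)) \<oplus> u \<otimes> s \<otimes> s1 \<otimes> (v \<otimes> (t \<otimes> r2))"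
      using c by algebra
    also have "\<dots> = (u \<otimes> v) \<otimes> ((s1 \<otimes> s2) \<otimes> (t \<otimes> a \<oplus> s \<otimes> b))"
      unfolding u(4)[symmetric] v(4)[symmetric] using c by algebra
    finally show ?thesis
      by (subst fraction_eq_iff) (use assms u v c mult_set_simps in auto)
  qed
  have "(a, s) \<in> fraction R S a s" "(b, t) \<in> fraction R S b t"
    using fraction_self assms by auto
  then show ?thesis
    unfolding localization_def monoid.simps ring.simps
    by (intro SUP_eq_const) (auto dest: eq)
qed

lemma localization_carrierE:
  assumes "x \<in> carrier (localization R S)"
  obtains r s where "r \<in> carrier R" "s \<in> S" "s \<in> carrier R" "x = fraction R S r s"
  using assms mult_set_simps(1) unfolding localization_def partial_object.simps by blast

lemma fraction_closed [intro]:
  "r \<in> carrier R \<Longrightarrow> s \<in> S \<Longrightarrow> fraction R S r s \<in> carrier (localization R S)"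
  unfolding localization_def by auto

lemma fraction_eqI:
  assumes "r \<in> carrier R" "r' \<in> carrier R" "s \<in> S" "s' \<in> S" "s' \<otimes> r = s \<otimes> r'"
  shows "fraction R S r s = fraction R S r' s'"
  unfolding fraction_eq_iff[OF assms(1-4)] assms(5) using mult_set_simps(2) by blast

lemma localization_zero: "\<zero>\<^bsub>localization R S\<^esub> = fraction R S \<zero> \<one>"
  and localization_one: "\<one>\<^bsub>localization R S\<^esub> = fraction R S \<one> \<one>"
  unfolding localization_def by auto

lemma localization_cring: "cring (localization R S)"
proof -
  note [simp] = localization_mult localization_add localization_zero localization_one
    mult_set_simps
  let ?L = "localization R S"
  show ?thesis
  proof (rule cringI)
    show "abelian_group ?L"
    proof (rule abelian_groupI)
      fix x y assume "x \<in> carrier ?L" "y \<in> carrier ?L"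
      then show "x \<oplus>\<^bsub>?L\<^esub> y \<in> carrier ?L"
        by (elim localization_carrierE) auto
    next
      show "\<zero>\<^bsub>?L\<^esub> \<in> carrier ?L" by auto
    next
      fix x y z assume "x \<in> carrier ?L" "y \<in> carrier ?L" "z \<in> carrier ?L"
      then show "x \<oplus>\<^bsub>?L\<^esub> y \<oplus>\<^bsub>?L\<^esub> z = x \<oplus>\<^bsub>?L\<^esub> (y \<oplus>\<^bsub>?L\<^esub> z)"
        by (elim localization_carrierE) (simp, rule fraction_eqI, simp_all add: l_distr r_distr m_ac a_ac)
    next
      fix x y assume "x \<in> carrier ?L" "y \<in> carrier ?L"
      then show "x \<oplus>\<^bsub>?L\<^esub> y = y \<oplus>\<^bsub>?L\<^esub> x"
        by (elim localization_carrierE) (simp, rule fraction_eqI, simp_all add: l_distr r_distr m_ac a_ac)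
    next
      fix x assume "x \<in> carrier ?L"
      then show "\<zero>\<^bsub>?L\<^esub> \<oplus>\<^bsub>?L\<^esub> x = x"
        by (elim localization_carrierE) simp
    next
      fix x assume "x \<in> carrier ?L"
      then obtain r s where x: "r \<in> carrier R" "s \<in> S" "s \<in> carrier R" "x = fraction R S r s"
        by (rule localization_carrierE)
      have "fraction R S (\<ominus> r) s \<oplus>\<^bsub>?L\<^esub> x = \<zero>\<^bsub>?L\<^esub>"
        using x by (simp, intro fraction_eqI, simp_all add: m_ac r_minus l_neg)
      then show "\<exists>y\<in>carrier ?L. y \<oplus>\<^bsub>?L\<^esub> x = \<zero>\<^bsub>?L\<^esub>"
        using fraction_closed[OF a_inv_closed[OF x(1)] x(2)] by blast
    qed
    show "comm_monoid ?L"
    proof (rule comm_monoidI)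
      fix x y assume "x \<in> carrier ?L" "y \<in> carrier ?L"
      then show "x \<otimes>\<^bsub>?L\<^esub> y \<in> carrier ?L"
        by (elim localization_carrierE) auto
    next
      show "\<one>\<^bsub>?L\<^esub> \<in> carrier ?L" by auto
    next
      fix x y z assume "x \<in> carrier ?L" "y \<in> carrier ?L" "z \<in> carrier ?L"
      then show "x \<otimes>\<^bsub>?L\<^esub> y \<otimes>\<^bsub>?L\<^esub> z = x \<otimes>\<^bsub>?L\<^esub> (y \<otimes>\<^bsub>?L\<^esub> z)"
        by (elim localization_carrierE) (simp add: m_assoc)
    next
      fix x y assume "x \<in> carrier ?L" "y \<in> carrier ?L"
      then show "x \<otimes>\<^bsub>?L\<^esub> y = y \<otimes>\<^bsub>?L\<^esub> x"
        by (elim localization_carrierE) (simp add: m_comm)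
    next
      fix x assume "x \<in> carrier ?L"
      then show "\<one>\<^bsub>?L\<^esub> \<otimes>\<^bsub>?L\<^esub> x = x"
        by (elim localization_carrierE) simp
    qed
    fix x y z assume "x \<in> carrier ?L" "y \<in> carrier ?L" "z \<in> carrier ?L"
    then show "(x \<oplus>\<^bsub>?L\<^esub> y) \<otimes>\<^bsub>?L\<^esub> z = x \<otimes>\<^bsub>?L\<^esub> z \<oplus>\<^bsub>?L\<^esub> y \<otimes>\<^bsub>?L\<^esub> z"
      by (elim localization_carrierE) (simp, rule fraction_eqI, simp_all add: l_distr r_distr m_ac a_ac)
  qed
qed

end


section \<open>The total ring of fractions\<close>

definition non_zerodivisors :: "('a, 'x) ring_scheme \<Rightarrow> 'a set" where
  "non_zerodivisors R =
     {a \<in> carrier R. \<forall>b\<in>carrier R. a \<otimes>\<^bsub>R\<^esub> b = \<zero>\<^bsub>R\<^esub> \<longrightarrow> b = \<zero>\<^bsub>R\<^esub>}"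

definition total_fractions :: "('a, 'x) ring_scheme \<Rightarrow> ('a \<times> 'a) set ring" where
  "total_fractions R = localization R (non_zerodivisors R)"

text \<open>The canonical embedding \<open>a \<mapsto> a / 1\<close>, along which \<open>R\<close> is regarded as a subring.\<close>

definition embed_fractions :: "('a, 'x) ring_scheme \<Rightarrow> 'a \<Rightarrow> ('a \<times> 'a) set" where
  "embed_fractions R a = fraction R (non_zerodivisors R) a \<one>\<^bsub>R\<^esub>"

lemma non_zerodivisors_submonoid:
  assumes "cring R" shows "submonoid (non_zerodivisors R) R"
proof -
  interpret cring R by (rule assms)
  have m: "x \<otimes>\<^bsub>R\<^esub> y \<in> non_zerodivisors R"
    if "x \<in> non_zerodivisors R" "y \<in> non_zerodivisors R" for x y
  proof -
    have c: "x \<in> carrier R" "y \<in> carrier R" using that unfolding non_zerodivisors_def by simp_all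
    moreover have "b = \<zero>\<^bsub>R\<^esub>"
      if b: "b \<in> carrier R" "x \<otimes>\<^bsub>R\<^esub> y \<otimes>\<^bsub>R\<^esub> b = \<zero>\<^bsub>R\<^esub>" for b
    proof -
      have "x \<otimes>\<^bsub>R\<^esub> (y \<otimes>\<^bsub>R\<^esub> b) = \<zero>\<^bsub>R\<^esub>" using b m_assoc[OF c b(1)] by simp
      then have "y \<otimes>\<^bsub>R\<^esub> b = \<zero>\<^bsub>R\<^esub>"
        using \<open>x \<in> non_zerodivisors R\<close> c b unfolding non_zerodivisors_def by blast
      then show ?thesis
        using \<open>y \<in> non_zerodivisors R\<close> b unfolding non_zerodivisors_def by blast
    qed
    ultimately show ?thesis unfolding non_zerodivisors_def by blast
  qed
  show ?thesis
  proof (rule submonoid.intro)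
    show "non_zerodivisors R \<subseteq> carrier R" unfolding non_zerodivisors_def by blast
    show "\<one>\<^bsub>R\<^esub> \<in> non_zerodivisors R" unfolding non_zerodivisors_def by simp
  qed (rule m)
qed

lemma inj_on_embed_fractions:
  assumes "cring R" shows "inj_on (embed_fractions R) (carrier R)"
proof (rule inj_onI)
  interpret cring R by (rule assms)
  note S = non_zerodivisors_submonoid[OF assms]
  fix x y assume c: "x \<in> carrier R" "y \<in> carrier R"
    and "embed_fractions R x = embed_fractions R y"
  then obtain t where t: "t \<in> non_zerodivisors R" "t \<otimes>\<^bsub>R\<^esub> x = t \<otimes>\<^bsub>R\<^esub> y"
    unfolding embed_fractions_def
    using fraction_eq_iff[OF assms S c submonoid.one_closed[OF S] submonoid.one_closed[OF S]]
    by auto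
  then have tc: "t \<in> carrier R" unfolding non_zerodivisors_def by auto
  have "t \<otimes>\<^bsub>R\<^esub> (x \<ominus>\<^bsub>R\<^esub> y) = t \<otimes>\<^bsub>R\<^esub> x \<ominus>\<^bsub>R\<^esub> t \<otimes>\<^bsub>R\<^esub> y"
    using c tc by algebra
  also have "\<dots> = \<zero>\<^bsub>R\<^esub>" using t(2) c tc by (simp add: r_right_minus_eq)
  finally have "x \<ominus>\<^bsub>R\<^esub> y = \<zero>\<^bsub>R\<^esub>"
    using t(1) c unfolding non_zerodivisors_def by auto
  then show "x = y" using c by (simp add: r_right_minus_eq)
qed

definition colon ::
  "('a, 'x) ring_scheme \<Rightarrow> ('a \<times> 'a) set set \<Rightarrow> ('a \<times> 'a) set set \<Rightarrow> ('a \<times> 'a) set set" where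
  "colon R U V =
     {q \<in> carrier (total_fractions R). \<forall>v\<in>V. q \<otimes>\<^bsub>total_fractions R\<^esub> v \<in> U}"


section \<open>Modules, injective dimension and Gorenstein rings\<close>

definition ring_module :: "('a, 'x) ring_scheme \<Rightarrow> ('a, 'a) module" where
  "ring_module R =
     \<lparr>carrier = carrier R, monoid.mult = monoid.mult R, one = one R, zero = zero R, add = add R,
      smult = monoid.mult R\<rparr>"

definition module_homs ::
  "('a, 'x) ring_scheme \<Rightarrow> ('a, 'm, 'y) module_scheme \<Rightarrow> ('a, 'n, 'z) module_scheme \<Rightarrow> ('m \<Rightarrow> 'n) set"
where
  "module_homs R M N =
     {f \<in> carrier M \<rightarrow> carrier N.
        (\<forall>x\<in>carrier M. \<forall>y\<in>carrier M. f (x \<oplus>\<^bsub>M\<^esub> y) = f x \<oplus>\<^bsub>N\<^esub> f y) \<and>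
        (\<forall>a\<in>carrier R. \<forall>x\<in>carrier M. f (a \<odot>\<^bsub>M\<^esub> x) = a \<odot>\<^bsub>N\<^esub> f x)}"

text \<open>
  A definition in HOL cannot quantify over all types, so the extension property is required for all
  modules \<open>M\<close>, \<open>N\<close> carried by \<^typ>\<open>'a set\<close>.  These include, up to isomorphism, all
  subquotients of \<open>R\<close> (as sets of cosets), in particular all inclusions of ideals into \<open>R\<close>, so by
  Baer's criterion nothing is lost.
\<close>

definition injective_module :: "('a, 'x) ring_scheme \<Rightarrow> ('a, 'e) module \<Rightarrow> bool" where
  "injective_module R E \<longleftrightarrow>
     module R E \<and>
     (\<forall>(M :: ('a, 'a set) module) (N :: ('a, 'a set) module).
        \<forall>i \<in> module_homs R M N. \<forall>f \<in> module_homs R M E.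
          module R M \<longrightarrow> module R N \<longrightarrow> inj_on i (carrier M) \<longrightarrow>
          (\<exists>g \<in> module_homs R N E. \<forall>x\<in>carrier M. g (i x) = f x))"

text \<open>\<open>0 \<rightarrow> M \<rightarrow> E 0 \<rightarrow> E 1 \<rightarrow> \<dots>\<close> with augmentation \<open>\<epsilon>\<close> and differentials \<open>d i\<close>.\<close>

definition injective_resolution ::
  "('a, 'x) ring_scheme \<Rightarrow> ('a, 'm) module \<Rightarrow>
   (nat \<Rightarrow> ('a, 'e) module) \<Rightarrow> ('m \<Rightarrow> 'e) \<Rightarrow> (nat \<Rightarrow> 'e \<Rightarrow> 'e) \<Rightarrow> bool"
where
  "injective_resolution R M E \<epsilon> d \<longleftrightarrow>
     (\<forall>i. injective_module R (E i)) \<and>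
     \<epsilon> \<in> module_homs R M (E 0) \<and>
     (\<forall>i. d i \<in> module_homs R (E i) (E (Suc i))) \<and>
     inj_on \<epsilon> (carrier M) \<and>
     \<epsilon> ` carrier M = {x \<in> carrier (E 0). d 0 x = \<zero>\<^bsub>E 1\<^esub>} \<and>
     (\<forall>i. d i ` carrier (E i) =
            {x \<in> carrier (E (Suc i)). d (Suc i) x = \<zero>\<^bsub>E (Suc (Suc i))\<^esub>})"

text \<open>
  The type argument is the type carrying the modules of the resolution.  When it is a type variable
  and the predicate is a hypothesis of a theorem, the theorem covers resolutions by modules of
  arbitrary carrier type.  All resolutions required in \<open>gorenstein_ring\<close> below can be carried by
  one sufficiently large type.
\<close>

definition finite_injective_dimension ::
  "'e itself \<Rightarrow> ('a, 'x) ring_scheme \<Rightarrow> ('a, 'm) module \<Rightarrow> bool" where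
  "finite_injective_dimension (_ :: 'e itself) R M \<longleftrightarrow>
     (\<exists>(n :: nat) (E :: nat \<Rightarrow> ('a, 'e) module) \<epsilon> d.
        injective_resolution R M E \<epsilon> d \<and> (\<forall>i>n. carrier (E i) = {\<zero>\<^bsub>E i\<^esub>}))"

definition gorenstein_ring :: "'e itself \<Rightarrow> ('a, 'x) ring_scheme \<Rightarrow> bool" where
  "gorenstein_ring T R \<longleftrightarrow>
     cring R \<and> noetherian_ring R \<and>
     (\<forall>\<mm>. maximalideal \<mm> R \<longrightarrow>
        (let R\<^sub>\<mm> = localization R (carrier R - \<mm>)
         in finite_injective_dimension T R\<^sub>\<mm> (ring_module R\<^sub>\<mm>)))"

text \<open>The zero ring gets dimension \<open>0\<close> here.\<close>

definition krull_dimension :: "('a, 'x) ring_scheme \<Rightarrow> enat" where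
  "krull_dimension R =
     Sup {enat n | n. \<exists>P. (\<forall>i\<le>n. primeideal (P i) R) \<and> (\<forall>i<n. P i \<subset> P (Suc i))}"


section \<open>Trace ideals and birational extensions\<close>

definition trace_of_module :: "('a, 'x) ring_scheme \<Rightarrow> ('a, 'm) module \<Rightarrow> 'a set" where
  "trace_of_module R M = Idl\<^bsub>R\<^esub> {f m | f m. f \<in> module_homs R M (ring_module R) \<and> m \<in> carrier M}"

text \<open>
  Only modules carried by \<^typ>\<open>'a\<close> are admitted as \<open>M\<close>; by \<open>trace_ideal_any_type\<close> below, modules
  carried by any other type give the same ideals.
\<close>

definition trace_ideal :: "'a set \<Rightarrow> ('a, 'x) ring_scheme \<Rightarrow> bool" where
  "trace_ideal I R \<longleftrightarrow> (\<exists>M :: ('a, 'a) module. module R M \<and> I = trace_of_module R M)"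

lemma ring_module_module:
  assumes "cring R" shows "module R (ring_module R)"
proof -
  interpret cring R by (rule assms)
  show ?thesis
    by (intro moduleI abelian_groupI assms)
      (auto simp: ring_module_def l_distr r_distr m_assoc a_ac intro: l_neg
        intro!: bexI[of _ "\<ominus>\<^bsub>R\<^esub> _"])
qed

theorem trace_ideal_any_type:
  fixes M :: "('a, 'm) module"
  assumes M: "module R M"
  shows "trace_ideal (trace_of_module R M) R"
proof -
  interpret module R M by (rule M)
  let ?G = "{f m | f m. f \<in> module_homs R M (ring_module R) \<and> m \<in> carrier M}"
  define I where "I = trace_of_module R M"
  have G: "?G \<subseteq> carrier R" unfolding module_homs_def ring_module_def by auto
  have I: "ideal I R" unfolding I_def trace_of_module_def using genideal_ideal[OF G] .
  interpret I: ideal I R by (rule I)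
  have GI: "?G \<subseteq> I" unfolding I_def trace_of_module_def using genideal_self[OF G] .
  let ?N = "ring_module R\<lparr>carrier := I\<rparr>"
  have "\<ominus>\<^bsub>ring_module R\<^esub> a = \<ominus>\<^bsub>R\<^esub> a" for a
    by (simp add: ring_module_def a_inv_def m_inv_def)
  then have "submodule I R (ring_module R)"
    using I.a_subset I.zero_closed
    by (intro module.submoduleI[OF ring_module_module[OF R.is_cring]])
      (auto simp: I.I_l_closed I.a_inv_closed I.a_closed, auto simp: ring_module_def I.I_l_closed)
  then have N: "module R ?N"
    by (rule submodule.submodule_is_module) (rule ring_module_module[OF R.is_cring])
  let ?H = "{f m | f m. f \<in> module_homs R ?N (ring_module R) \<and> m \<in> carrier ?N}"
  have H: "?H \<subseteq> carrier R" unfolding module_homs_def ring_module_def by auto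
  have "?H \<subseteq> I"
  proof safe
    fix h x assume h: "h \<in> module_homs R ?N (ring_module R)" and x: "x \<in> carrier ?N"
    have hI: "h a \<in> carrier R" if "a \<in> I" for a
      using h that unfolding module_homs_def ring_module_def by auto
    have hadd: "h (a \<oplus>\<^bsub>R\<^esub> b) = h a \<oplus>\<^bsub>R\<^esub> h b" if "a \<in> I" "b \<in> I" for a b
      using h that unfolding module_homs_def ring_module_def by auto
    have hmul: "h (a \<otimes>\<^bsub>R\<^esub> b) = a \<otimes>\<^bsub>R\<^esub> h b" if "a \<in> carrier R" "b \<in> I" for a b
      using h that unfolding module_homs_def ring_module_def by auto
    have hmul': "h (b \<otimes>\<^bsub>R\<^esub> a) = a \<otimes>\<^bsub>R\<^esub> h b" if "a \<in> carrier R" "b \<in> I" for a b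
      using hmul[OF that] R.m_comm[OF that(1) I.Icarr[OF that(2)]] by simp
    let ?J = "{a \<in> I. h a \<in> I}"
    have h0: "h \<zero>\<^bsub>R\<^esub> = \<zero>\<^bsub>R\<^esub>"
      using hmul[of "\<zero>\<^bsub>R\<^esub>" "\<zero>\<^bsub>R\<^esub>"] hI[of "\<zero>\<^bsub>R\<^esub>"] by auto
    have hneg: "h (\<ominus>\<^bsub>R\<^esub> a) = \<ominus>\<^bsub>R\<^esub> h a" if "a \<in> I" for a
      using hmul[of "\<ominus>\<^bsub>R\<^esub> \<one>\<^bsub>R\<^esub>" a] that hI[of a] I.Icarr[OF that]
      by (simp add: R.l_minus)
    have "ideal ?J R"
      by (rule idealI[OF R.ring_axioms])
        (auto intro!: subgroup.intro
          simp: h0 hadd hmul hmul' hneg I.I_l_closed I.I_r_closed I.Icarr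
            I.a_inv_closed[unfolded a_inv_def] hneg[unfolded a_inv_def])
    moreover have "?G \<subseteq> ?J"
    proof safe
      fix f m assume f: "f \<in> module_homs R M (ring_module R)" and m: "m \<in> carrier M"
      show fm: "f m \<in> I" using GI f m by blast
      have "(\<lambda>m. h (f m)) \<in> module_homs R M (ring_module R)"
      proof -
        have fI: "f y \<in> I" if "y \<in> carrier M" for y using GI f that by blast
        have "f (y \<oplus>\<^bsub>M\<^esub> z) = f y \<oplus>\<^bsub>R\<^esub> f z"
          if "y \<in> carrier M" "z \<in> carrier M" for y z
          using f that unfolding module_homs_def ring_module_def by auto
        moreover have "f (a \<odot>\<^bsub>M\<^esub> y) = a \<otimes>\<^bsub>R\<^esub> f y"
          if "a \<in> carrier R" "y \<in> carrier M" for a y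
          using f that unfolding module_homs_def ring_module_def by auto
        ultimately show ?thesis
          using fI hI hadd hmul unfolding module_homs_def by (auto simp: ring_module_def)
      qed
      then show "h (f m) \<in> I" using GI m by blast
    qed
    ultimately have "I \<subseteq> ?J"
      unfolding I_def trace_of_module_def using R.genideal_minimal by blast
    then show "h x \<in> I" using x by auto
  qed
  then have "Idl\<^bsub>R\<^esub> ?H \<subseteq> I" by (rule R.genideal_minimal[OF I])
  moreover have "I \<subseteq> Idl\<^bsub>R\<^esub> ?H"
  proof
    fix x assume x: "x \<in> I"
    have "(\<lambda>a. a) \<in> module_homs R ?N (ring_module R)"
      unfolding module_homs_def ring_module_def using I.Icarr by auto
    then have "x \<in> ?H" using x by fastforce
    then show "x \<in> Idl\<^bsub>R\<^esub> ?H" using R.genideal_self[OF H] by blast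
  qed
  ultimately have "I = trace_of_module R ?N" unfolding trace_of_module_def by blast
  then show ?thesis unfolding trace_ideal_def I_def[symmetric] using N by blast
qed

definition regular_trace_ideals :: "('a, 'x) ring_scheme \<Rightarrow> 'a set set" where
  "regular_trace_ideals R = {I. trace_ideal I R \<and> I \<inter> non_zerodivisors R \<noteq> {}}"

definition birational_extensions :: "('a, 'x) ring_scheme \<Rightarrow> ('a \<times> 'a) set set set" where
  "birational_extensions R =
     {A. subring A (total_fractions R) \<and>
         embed_fractions R ` carrier R \<subseteq> A \<and>
         (\<exists>a \<in> non_zerodivisors R. \<forall>x\<in>A.
            embed_fractions R a \<otimes>\<^bsub>total_fractions R\<^esub> x \<in> embed_fractions R ` carrier R)}"

definition rho :: "('a, 'x) ring_scheme \<Rightarrow> 'a set \<Rightarrow> ('a \<times> 'a) set set" where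
  "rho R I = colon R (embed_fractions R ` I) (embed_fractions R ` I)"

text \<open>
  As \<open>1 \<in> A\<close>, the colon \<open>R : A\<close> lies in the image of \<open>R\<close>; it is pulled back to an ideal of \<open>R\<close>.
\<close>

definition eta :: "('a, 'x) ring_scheme \<Rightarrow> ('a \<times> 'a) set set \<Rightarrow> 'a set" where
  "eta R A =
     {r \<in> carrier R. embed_fractions R r \<in> colon R (embed_fractions R ` carrier R) A}"

end

theory Submission
  imports Defs
begin

text \<open>
  The theorem reduces to one fact: in a Gorenstein ring of dimension at most one, every ideal \<open>J\<close> that
  contains a nonzerodivisor is divisorial, \<open>R : (R : J) = J\<close>.  Multiplying by a nonzerodivisor \<open>x \<in> J\<close>,
  this becomes the statement \<open>x R : (x R : J) = J\<close> about ideal quotients in \<open>R\<close> itself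
  (\<open>double_ideal_quotient_gorenstein\<close>).

  Given this, let \<open>I\<close> be a regular trace ideal.  Every element of \<open>R : I\<close> is a homomorphism \<open>I \<rightarrow> R\<close>, which maps
  the trace ideal \<open>I\<close> into itself, so \<open>R : I = I : I\<close> (\<open>trace_ideal_multiplier\<close>) and
  \<open>R : (I : I) = R : (R : I) = I\<close>.  For a birational extension \<open>A\<close> the conductor \<open>c = R : A\<close> is an ideal of
  \<open>A\<close>.  Hence \<open>(R : c) c \<subseteq> c\<close>, which makes \<open>c\<close> a trace ideal (\<open>trace_ideal_of_multipliers\<close>), and
  \<open>c : c = R : c = R : (R : A)\<close>.  This is \<open>A\<close>, because \<open>a A\<close> is a regular ideal of \<open>R\<close> for some nonzerodivisor
  \<open>a\<close>.

  The equality \<open>x R : (x R : J) = J\<close> is local, and in dimension one a prime ideal containing the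
  nonzerodivisor \<open>x\<close> is maximal.  So it suffices to treat a Noetherian ring \<open>R\<close> of finite injective
  dimension in which at most one prime ideal \<open>P\<close> contains \<open>x\<close> (\<open>double_ideal_quotient_principal\<close>).  There
  one first shows \<open>Ext\<^sup>i(R / J, R) = 0\<close> for \<open>i \<ge> 2\<close> and all ideals \<open>J\<close> containing \<open>x\<close>, by descending
  induction on \<open>i\<close>.  If \<open>Ext\<^sup>i\<^sup>+\<^sup>1\<close> vanishes on these modules, then the embedding of \<open>R / P\<close> into \<open>R / x R\<close>
  makes \<open>Ext\<^sup>i(R / P, R)\<close> a quotient of \<open>Ext\<^sup>i(R / x R, R)\<close>, which is zero since \<open>R / x R\<close> has projective
  dimension one; and every \<open>R / J\<close> is built from copies of \<open>R / P\<close>.  The vanishing of \<open>Ext\<^sup>2\<close> makes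
  \<open>Ext\<^sup>1(R / J, R) = Hom(R / J, R / x R)\<close> exact in \<open>R / J\<close>, that is, \<open>R / x R\<close> is self-injective; and an
  Artinian local self-injective ring has the double annihilator property.

  Only cyclic modules occur, and \<open>Hom(R / J, E)\<close> consists of the elements of \<open>E\<close> killed by \<open>J\<close>.  So all of
  this is carried out with elements of the modules of an injective resolution of \<open>R\<close>, and injectivity
  enters only through Baer's property.
\<close>

section \<open>Ideal quotients in Noetherian rings\<close>

lemma (in cring) ideal_of_closed:
  assumes "I \<subseteq> carrier R" "\<zero> \<in> I"
    and add: "\<And>a b. a \<in> I \<Longrightarrow> b \<in> I \<Longrightarrow> a \<oplus> b \<in> I"
    and mult: "\<And>a r. a \<in> I \<Longrightarrow> r \<in> carrier R \<Longrightarrow> r \<otimes> a \<in> I"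
  shows "ideal I R"
proof -
  have "\<ominus> a \<in> I" if "a \<in> I" for a
    using mult[OF that, of "\<ominus> \<one>"] assms(1) that by (auto simp: l_minus)
  then have "subgroup I (add_monoid R)"
    using assms by (intro subgroup.intro) (auto simp flip: a_inv_def)
  then show ?thesis
    using assms mult by (intro idealI ring_axioms) (auto simp: m_comm subset_iff)
qed

lemma ideal_simps:
  assumes "ideal I R"
  shows "\<And>a. a \<in> I \<Longrightarrow> a \<in> carrier R" "\<zero>\<^bsub>R\<^esub> \<in> I"
    "\<And>a b. a \<in> I \<Longrightarrow> b \<in> I \<Longrightarrow> a \<oplus>\<^bsub>R\<^esub> b \<in> I"
    "\<And>a r. a \<in> I \<Longrightarrow> r \<in> carrier R \<Longrightarrow> r \<otimes>\<^bsub>R\<^esub> a \<in> I"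
    "\<And>a r. a \<in> I \<Longrightarrow> r \<in> carrier R \<Longrightarrow> a \<otimes>\<^bsub>R\<^esub> r \<in> I"
    "\<And>a b. a \<in> I \<Longrightarrow> b \<in> I \<Longrightarrow> a \<ominus>\<^bsub>R\<^esub> b \<in> I"
    "\<And>a. a \<in> I \<Longrightarrow> \<ominus>\<^bsub>R\<^esub> a \<in> I"
proof -
  interpret ideal I R by (rule assms)
  show "\<And>a. a \<in> I \<Longrightarrow> a \<in> carrier R" "\<zero>\<^bsub>R\<^esub> \<in> I"
    "\<And>a b. a \<in> I \<Longrightarrow> b \<in> I \<Longrightarrow> a \<oplus>\<^bsub>R\<^esub> b \<in> I"
    "\<And>a r. a \<in> I \<Longrightarrow> r \<in> carrier R \<Longrightarrow> r \<otimes>\<^bsub>R\<^esub> a \<in> I"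
    "\<And>a r. a \<in> I \<Longrightarrow> r \<in> carrier R \<Longrightarrow> a \<otimes>\<^bsub>R\<^esub> r \<in> I"
    "\<And>a b. a \<in> I \<Longrightarrow> b \<in> I \<Longrightarrow> a \<ominus>\<^bsub>R\<^esub> b \<in> I"
    "\<And>a. a \<in> I \<Longrightarrow> \<ominus>\<^bsub>R\<^esub> a \<in> I"
    by (auto simp: I_l_closed I_r_closed a_minus_def Icarr)
qed

definition ideal_quotient :: "('a, 'x) ring_scheme \<Rightarrow> 'a set \<Rightarrow> 'a set \<Rightarrow> 'a set" where
  "ideal_quotient R J K = {r \<in> carrier R. \<forall>k\<in>K. r \<otimes>\<^bsub>R\<^esub> k \<in> J}"

lemma (in cring) ideal_ideal_quotient:
  assumes "ideal J R" "K \<subseteq> carrier R"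
  shows "ideal (ideal_quotient R J K) R"
proof (rule ideal_of_closed)
  note J = ideal_simps[OF assms(1)]
  have K: "k \<in> carrier R" if "k \<in> K" for k using that assms(2) by blast
  show "ideal_quotient R J K \<subseteq> carrier R" by (auto simp: ideal_quotient_def)
  show "\<zero> \<in> ideal_quotient R J K" by (simp add: ideal_quotient_def J(2) K)
  show "a \<oplus> b \<in> ideal_quotient R J K"
    if "a \<in> ideal_quotient R J K" "b \<in> ideal_quotient R J K" for a b
    using that by (simp add: ideal_quotient_def J(3) K l_distr)
  show "r \<otimes> a \<in> ideal_quotient R J K"
    if "a \<in> ideal_quotient R J K" "r \<in> carrier R" for a r
    using that by (simp add: ideal_quotient_def J(4) K m_assoc)
qed

lemma (in cring) ideal_quotient_superset:
  assumes "ideal J R" "K \<subseteq> carrier R"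
  shows "J \<subseteq> ideal_quotient R J K"
  using ideal_simps(1,5)[OF assms(1)] assms(2) unfolding ideal_quotient_def by blast

lemma (in cring) proper_ideal_quotient:
  assumes "a \<in> carrier R" "a \<notin> J"
  shows "ideal_quotient R J {a} \<noteq> carrier R"
proof -
  have "\<one> \<notin> ideal_quotient R J {a}" using assms by (simp add: ideal_quotient_def)
  then show ?thesis using one_closed by blast
qed

lemma (in cring) nonzerodivisor_cancel:
  assumes "x \<in> non_zerodivisors R" "u \<in> carrier R" "v \<in> carrier R" "x \<otimes> u = x \<otimes> v"
  shows "u = v"
proof -
  have x: "x \<in> carrier R" using assms(1) by (simp add: non_zerodivisors_def)
  have "x \<otimes> (u \<ominus> v) = x \<otimes> u \<ominus> x \<otimes> v" using x assms(2,3) by algebra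
  also have "\<dots> = \<zero>" using assms x by (simp add: r_right_minus_eq)
  finally have "u \<ominus> v = \<zero>" using assms(1-3) by (simp add: non_zerodivisors_def)
  then show ?thesis using assms(2,3) by (simp add: r_right_minus_eq)
qed

lemma (in cring) mem_PIdl_iff:
  "x \<in> carrier R \<Longrightarrow> r \<in> PIdl x \<longleftrightarrow> (\<exists>s\<in>carrier R. r = x \<otimes> s)"
  unfolding cgenideal_def using m_comm[of x] by auto

lemma (in cring) ideal_adjoin:
  assumes "ideal J R" "a \<in> carrier R"
  shows "ideal (J <+>\<^bsub>R\<^esub> PIdl a) R"
    and "\<And>c. c \<in> J <+>\<^bsub>R\<^esub> PIdl a \<longleftrightarrow> (\<exists>b\<in>J. \<exists>r\<in>carrier R. c = b \<oplus> r \<otimes> a)"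
    and "J \<subseteq> J <+>\<^bsub>R\<^esub> PIdl a" "a \<in> J <+>\<^bsub>R\<^esub> PIdl a"
proof -
  note J = ideal_simps[OF assms(1)]
  show "ideal (J <+>\<^bsub>R\<^esub> PIdl a) R" using add_ideals[OF assms(1) cgenideal_ideal[OF assms(2)]] .
  show iff: "c \<in> J <+>\<^bsub>R\<^esub> PIdl a \<longleftrightarrow> (\<exists>b\<in>J. \<exists>r\<in>carrier R. c = b \<oplus> r \<otimes> a)" for c
    unfolding set_add_def' cgenideal_def by auto
  show "J \<subseteq> J <+>\<^bsub>R\<^esub> PIdl a"
  proof
    fix b assume "b \<in> J"
    then have "b = b \<oplus> \<zero> \<otimes> a" using J(1) assms(2) by simp
    then show "b \<in> J <+>\<^bsub>R\<^esub> PIdl a" unfolding iff using \<open>b \<in> J\<close> by blast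
  qed
  have "a = \<zero> \<oplus> \<one> \<otimes> a" using assms(2) by simp
  then show "a \<in> J <+>\<^bsub>R\<^esub> PIdl a" unfolding iff using J(2) by blast
qed

lemma (in noetherian_ring) ideal_family_maximal:
  assumes "F \<noteq> {}" "\<And>I. I \<in> F \<Longrightarrow> ideal I R"
  shows "\<exists>M\<in>F. \<forall>I\<in>F. M \<subseteq> I \<longrightarrow> I = M"
proof (rule subset_Zorn)
  fix C assume C: "subset.chain F C"
  show "\<exists>U\<in>F. \<forall>X\<in>C. X \<subseteq> U"
  proof (cases "C = {}")
    case False
    have "subset.chain {I. ideal I R} C"
      using C assms(2) unfolding pred_on.chain_def by auto
    then have "\<Union>C \<in> C" by (rule ideal_chain_is_trivial[OF False])
    moreover have "C \<subseteq> F" using C unfolding pred_on.chain_def by auto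
    ultimately show ?thesis by (intro bexI[of _ "\<Union>C"]) auto
  qed (use assms(1) in auto)
qed

text \<open>
  A maximal element among the annihilators \<open>J : a\<close> of nonzero classes of \<open>R / J\<close> is prime, because
  \<open>J : a \<subseteq> J : (b \<otimes> a)\<close>.
\<close>

lemma (in cring) associated_prime_exists:
  assumes "noetherian_ring R" "ideal J R" "J \<noteq> carrier R"
  obtains a where "a \<in> carrier R" "a \<notin> J" "primeideal (ideal_quotient R J {a}) R"
proof -
  note J = ideal_simps[OF assms(2)]
  let ?F = "{ideal_quotient R J {a} | a. a \<in> carrier R \<and> a \<notin> J}"
  have "?F \<noteq> {}" using assms(3) J(1) by auto
  moreover have "ideal I R" if "I \<in> ?F" for I
    using that ideal_ideal_quotient[OF assms(2)] by auto
  ultimately have "\<exists>M\<in>?F. \<forall>I\<in>?F. M \<subseteq> I \<longrightarrow> I = M"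
    by (rule noetherian_ring.ideal_family_maximal[OF assms(1)])
  then obtain M where "M \<in> ?F" and max: "\<And>I. I \<in> ?F \<Longrightarrow> M \<subseteq> I \<Longrightarrow> I = M" by blast
  then obtain a where a: "a \<in> carrier R" "a \<notin> J" and M: "M = ideal_quotient R J {a}" by auto
  have "primeideal M R"
  proof (rule primeidealI)
    show "ideal M R" unfolding M using ideal_ideal_quotient[OF assms(2)] a by simp
    show "cring R" by (rule is_cring)
    show "carrier R \<noteq> M" unfolding M using proper_ideal_quotient[OF a] by simp
    fix u v assume u: "u \<in> carrier R" and v: "v \<in> carrier R" and uv: "u \<otimes> v \<in> M"
    show "u \<in> M \<or> v \<in> M"
    proof (cases "v \<in> M")
      case False
      then have "v \<otimes> a \<notin> J" unfolding M ideal_quotient_def using v by auto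
      then have "ideal_quotient R J {v \<otimes> a} \<in> ?F" using a v by auto
      moreover have "M \<subseteq> ideal_quotient R J {v \<otimes> a}"
      proof
        fix r assume "r \<in> M"
        then have r: "r \<in> carrier R" "r \<otimes> a \<in> J" by (auto simp: M ideal_quotient_def)
        then show "r \<in> ideal_quotient R J {v \<otimes> a}"
          using J(4)[OF r(2) v] a v by (simp add: ideal_quotient_def m_lcomm)
      qed
      ultimately have "ideal_quotient R J {v \<otimes> a} = M" by (rule max)
      moreover have "u \<in> ideal_quotient R J {v \<otimes> a}"
        using uv u v a by (simp add: M ideal_quotient_def m_assoc)
      ultimately show ?thesis by simp
    qed simp
  qed
  with that a show thesis unfolding M by blast
qed

section \<open>Injective modules and Baer's property\<close>

lemma module_homsD:
  assumes "f \<in> module_homs R M N"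
  shows "\<And>x. x \<in> carrier M \<Longrightarrow> f x \<in> carrier N"
    "\<And>x y. x \<in> carrier M \<Longrightarrow> y \<in> carrier M \<Longrightarrow> f (x \<oplus>\<^bsub>M\<^esub> y) = f x \<oplus>\<^bsub>N\<^esub> f y"
    "\<And>a x. a \<in> carrier R \<Longrightarrow> x \<in> carrier M \<Longrightarrow> f (a \<odot>\<^bsub>M\<^esub> x) = a \<odot>\<^bsub>N\<^esub> f x"
  using assms unfolding module_homs_def by auto

lemma module_hom_zero_minus:
  assumes "module R M" "module R N" "f \<in> module_homs R M N"
  shows "f \<zero>\<^bsub>M\<^esub> = \<zero>\<^bsub>N\<^esub>"
    "\<And>x y. x \<in> carrier M \<Longrightarrow> y \<in> carrier M \<Longrightarrow> f (x \<ominus>\<^bsub>M\<^esub> y) = f x \<ominus>\<^bsub>N\<^esub> f y"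
proof -
  interpret M: module R M by (rule assms)
  interpret N: module R N by (rule assms)
  note f = module_homsD[OF assms(3)]
  have z: "\<zero>\<^bsub>M\<^esub> \<in> carrier M" by (rule M.zero_closed)
  have "f \<zero>\<^bsub>M\<^esub> = f (\<zero>\<^bsub>R\<^esub> \<odot>\<^bsub>M\<^esub> \<zero>\<^bsub>M\<^esub>)" by (subst M.smult_l_null) auto
  also have "\<dots> = \<zero>\<^bsub>R\<^esub> \<odot>\<^bsub>N\<^esub> f \<zero>\<^bsub>M\<^esub>" by (rule f(3)) auto
  also have "\<dots> = \<zero>\<^bsub>N\<^esub>" by (rule N.smult_l_null) (rule f(1)[OF z])
  finally show "f \<zero>\<^bsub>M\<^esub> = \<zero>\<^bsub>N\<^esub>" .
  fix x y assume c: "x \<in> carrier M" "y \<in> carrier M"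
  have "f (\<ominus>\<^bsub>M\<^esub> y) = \<ominus>\<^bsub>N\<^esub> f y"
    using f(3)[of "\<ominus>\<^bsub>R\<^esub> \<one>\<^bsub>R\<^esub>" y] c f(1)[of y] by (simp add: M.smult_l_minus N.smult_l_minus)
  then show "f (x \<ominus>\<^bsub>M\<^esub> y) = f x \<ominus>\<^bsub>N\<^esub> f y"
    using f(2)[of x "\<ominus>\<^bsub>M\<^esub> y"] c by (simp add: a_minus_def)
qed

text \<open>
  The ideal \<open>J\<close>, as a module whose elements are the singletons \<open>{r}\<close>: injectivity tests only modules
  whose elements are sets of ring elements.
\<close>

definition singleton_module :: "('a, 'x) ring_scheme \<Rightarrow> 'a set \<Rightarrow> ('a, 'a set) module" where
  "singleton_module R J =
     \<lparr>carrier = (\<lambda>r. {r}) ` J, monoid.mult = (\<lambda>p q. {the_elem p \<otimes>\<^bsub>R\<^esub> the_elem q}),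
      one = {\<one>\<^bsub>R\<^esub>}, zero = {\<zero>\<^bsub>R\<^esub>}, add = (\<lambda>p q. {the_elem p \<oplus>\<^bsub>R\<^esub> the_elem q}),
      smult = (\<lambda>a p. {a \<otimes>\<^bsub>R\<^esub> the_elem p})\<rparr>"

lemma (in cring) module_singleton_module:
  assumes "ideal J R"
  shows "module R (singleton_module R J)"
proof -
  note J = ideal_simps[OF assms]
  let ?S = "singleton_module R J"
  have sub: "J \<subseteq> carrier R" using J(1) by blast
  have el: "\<exists>b\<in>J. p = {b}" if "p \<in> carrier ?S" for p
    using that by (auto simp: singleton_module_def)
  have car: "{b} \<in> carrier ?S" if "b \<in> J" for b
    using that by (auto simp: singleton_module_def)
  have op [simp]: "{a} \<oplus>\<^bsub>?S\<^esub> {b} = {a \<oplus> b}" "r \<odot>\<^bsub>?S\<^esub> {b} = {r \<otimes> b}" "\<zero>\<^bsub>?S\<^esub> = {\<zero>}"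
    for a b r by (simp_all add: singleton_module_def)
  show ?thesis
  proof (rule moduleI)
    show "cring R" by (rule is_cring)
    show "abelian_group ?S"
    proof (rule abelian_groupI)
      fix p assume "p \<in> carrier ?S"
      then obtain b where b: "b \<in> J" "p = {b}" using el by blast
      then have "{\<ominus> b} \<in> carrier ?S" "{\<ominus> b} \<oplus>\<^bsub>?S\<^esub> p = \<zero>\<^bsub>?S\<^esub>"
        using car J(1,7) by (auto simp: l_neg)
      then show "\<exists>q\<in>carrier ?S. q \<oplus>\<^bsub>?S\<^esub> p = \<zero>\<^bsub>?S\<^esub>" by blast
    next
      show "\<zero>\<^bsub>?S\<^esub> \<in> carrier ?S" using car J(2) by simp
    qed (use el car J(3) sub in \<open>auto dest!: el simp: subset_iff a_ac\<close>)
  qed (use el car J(4) sub in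
      \<open>auto dest!: el simp: subset_iff l_distr r_distr m_assoc\<close>)
qed

lemma (in cring) baer_property:
  assumes E: "injective_module R E" and J: "ideal J R"
    and f: "\<And>b. b \<in> J \<Longrightarrow> f b \<in> carrier E"
      "\<And>a b. a \<in> J \<Longrightarrow> b \<in> J \<Longrightarrow> f (a \<oplus> b) = f a \<oplus>\<^bsub>E\<^esub> f b"
      "\<And>a b. a \<in> carrier R \<Longrightarrow> b \<in> J \<Longrightarrow> f (a \<otimes> b) = a \<odot>\<^bsub>E\<^esub> f b"
  obtains e where "e \<in> carrier E" "\<And>b. b \<in> J \<Longrightarrow> b \<odot>\<^bsub>E\<^esub> e = f b"
proof -
  note Js = ideal_simps[OF J]
  let ?M = "singleton_module R J" and ?N = "singleton_module R (carrier R)"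
  have "(\<lambda>p. p) \<in> module_homs R ?M ?N" "(\<lambda>p. f (the_elem p)) \<in> module_homs R ?M E"
    unfolding module_homs_def singleton_module_def using Js f by auto
  moreover note module_singleton_module[OF J] module_singleton_module[OF oneideal]
  moreover have "inj_on (\<lambda>p. p) (carrier ?M)" by simp
  ultimately obtain g where g: "g \<in> module_homs R ?N E"
    and gf: "\<forall>p\<in>carrier ?M. g p = f (the_elem p)"
    using E unfolding injective_module_def by meson
  have one: "{\<one>} \<in> carrier ?N" by (simp add: singleton_module_def)
  show thesis
  proof (rule that)
    show "g {\<one>} \<in> carrier E" using module_homsD(1)[OF g one] .
    fix b assume b: "b \<in> J"
    have "b \<odot>\<^bsub>E\<^esub> g {\<one>} = g (b \<odot>\<^bsub>?N\<^esub> {\<one>})"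
      using module_homsD(3)[OF g _ one] Js(1)[OF b] by simp
    also have "\<dots> = g {b}" using Js(1)[OF b] by (simp add: singleton_module_def)
    also have "\<dots> = f b" using gf b by (auto simp: singleton_module_def)
    finally show "b \<odot>\<^bsub>E\<^esub> g {\<one>} = f b" .
  qed
qed


section \<open>Ext of cyclic modules\<close>

locale ring_resolution = cring R for R (structure) +
  fixes E :: "nat \<Rightarrow> ('a, 'e) module" and \<epsilon> d
  assumes resolution: "injective_resolution R (ring_module R) E \<epsilon> d"
begin

lemma injective_E: "injective_module R (E i)"
  using resolution unfolding injective_resolution_def by blast

sublocale E: module R "E i" for i
  using injective_E unfolding injective_module_def by blast

lemma d_hom: "d i \<in> module_homs R (E i) (E (Suc i))"
  and \<epsilon>_hom: "\<epsilon> \<in> module_homs R (ring_module R) (E 0)"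
  using resolution unfolding injective_resolution_def by blast+

lemmas d_closed = module_homsD(1)[OF d_hom]
lemmas d_add = module_homsD(2)[OF d_hom]
lemmas d_smult = module_homsD(3)[OF d_hom]
lemmas d_zero = module_hom_zero_minus(1)[OF E.module_axioms E.module_axioms d_hom]
lemmas d_minus = module_hom_zero_minus(2)[OF E.module_axioms E.module_axioms d_hom]

lemma \<epsilon>_closed: "r \<in> carrier R \<Longrightarrow> \<epsilon> r \<in> carrier (E 0)"
  and \<epsilon>_add: "r \<in> carrier R \<Longrightarrow> s \<in> carrier R \<Longrightarrow> \<epsilon> (r \<oplus> s) = \<epsilon> r \<oplus>\<^bsub>E 0\<^esub> \<epsilon> s"
  and \<epsilon>_mult: "r \<in> carrier R \<Longrightarrow> s \<in> carrier R \<Longrightarrow> \<epsilon> (r \<otimes> s) = r \<odot>\<^bsub>E 0\<^esub> \<epsilon> s"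
  using module_homsD[OF \<epsilon>_hom] by (simp_all add: ring_module_def)

lemma \<epsilon>_minus: "r \<in> carrier R \<Longrightarrow> s \<in> carrier R \<Longrightarrow> \<epsilon> (r \<ominus> s) = \<epsilon> r \<ominus>\<^bsub>E 0\<^esub> \<epsilon> s"
proof -
  have "r \<ominus>\<^bsub>ring_module R\<^esub> s = r \<ominus> s"
    by (simp add: ring_module_def a_minus_def a_inv_def m_inv_def)
  then show "r \<in> carrier R \<Longrightarrow> s \<in> carrier R \<Longrightarrow> ?thesis"
    using module_hom_zero_minus(2)[OF ring_module_module[OF is_cring] E.module_axioms \<epsilon>_hom, of r s]
    by (simp add: ring_module_def)
qed

lemma \<epsilon>_inj: "r \<in> carrier R \<Longrightarrow> s \<in> carrier R \<Longrightarrow> \<epsilon> r = \<epsilon> s \<Longrightarrow> r = s"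
  using resolution unfolding injective_resolution_def inj_on_def ring_module_def by auto

lemma exact_0: "e \<in> carrier (E 0) \<Longrightarrow> d 0 e = \<zero>\<^bsub>E 1\<^esub> \<Longrightarrow> \<exists>r\<in>carrier R. e = \<epsilon> r"
  using resolution unfolding injective_resolution_def ring_module_def by fastforce

lemma d_\<epsilon>: "r \<in> carrier R \<Longrightarrow> d 0 (\<epsilon> r) = \<zero>\<^bsub>E 1\<^esub>"
  using resolution unfolding injective_resolution_def ring_module_def by fastforce

lemma exact_Suc:
  "e \<in> carrier (E (Suc i)) \<Longrightarrow> d (Suc i) e = \<zero>\<^bsub>E (Suc (Suc i))\<^esub> \<Longrightarrow> \<exists>y\<in>carrier (E i). e = d i y"
  using resolution unfolding injective_resolution_def by blast

lemma d_d: "e \<in> carrier (E i) \<Longrightarrow> d (Suc i) (d i e) = \<zero>\<^bsub>E (Suc (Suc i))\<^esub>"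
  using resolution unfolding injective_resolution_def by blast

text \<open>
  The elements of \<open>E i\<close> killed by \<open>J\<close> form \<open>Hom(R / J, E i)\<close>; these groups with the differentials
  \<open>d\<close> compute \<open>Ext(R / J, R)\<close>.  Thus \<open>ext_zero i J\<close> says that \<open>Ext\<^sup>i\<^sup>+\<^sup>1(R / J, R) = 0\<close>.
\<close>

definition killed :: "nat \<Rightarrow> 'a set \<Rightarrow> 'e set" where
  "killed i J = {e \<in> carrier (E i). \<forall>b\<in>J. b \<odot>\<^bsub>E i\<^esub> e = \<zero>\<^bsub>E i\<^esub>}"

definition ext_zero :: "nat \<Rightarrow> 'a set \<Rightarrow> bool" where
  "ext_zero i J \<longleftrightarrow>
     (\<forall>z\<in>killed (Suc i) J. d (Suc i) z = \<zero>\<^bsub>E (Suc (Suc i))\<^esub> \<longrightarrow> z \<in> d i ` killed i J)"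

lemma killed_carrier: "e \<in> killed i J \<Longrightarrow> e \<in> carrier (E i)"
  by (simp add: killed_def)

lemma d_killed:
  assumes "J \<subseteq> carrier R" "e \<in> killed i J" shows "d i e \<in> killed (Suc i) J"
proof -
  have "b \<odot>\<^bsub>E (Suc i)\<^esub> d i e = \<zero>\<^bsub>E (Suc i)\<^esub>" if "b \<in> J" for b
    using d_smult[of b e i] assms that d_zero by (auto simp: killed_def)
  then show ?thesis using assms by (simp add: killed_def d_closed)
qed

lemma killed_minus:
  assumes "J \<subseteq> carrier R" "e \<in> killed i J" "e' \<in> killed i J" shows "e \<ominus>\<^bsub>E i\<^esub> e' \<in> killed i J"
proof -
  have "b \<odot>\<^bsub>E i\<^esub> (e \<ominus>\<^bsub>E i\<^esub> e') = \<zero>\<^bsub>E i\<^esub>" if "b \<in> J" for b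
    using assms that by (auto simp: killed_def a_minus_def E.smult_r_distr E.smult_r_minus)
  then show ?thesis using assms by (simp add: killed_def)
qed

lemma killed_add:
  assumes "J \<subseteq> carrier R" "e \<in> killed i J" "e' \<in> killed i J" shows "e \<oplus>\<^bsub>E i\<^esub> e' \<in> killed i J"
proof -
  have "b \<odot>\<^bsub>E i\<^esub> (e \<oplus>\<^bsub>E i\<^esub> e') = \<zero>\<^bsub>E i\<^esub>" if "b \<in> J" for b
    using assms that by (auto simp: killed_def E.smult_r_distr)
  then show ?thesis using assms by (simp add: killed_def)
qed

lemma killed_antimono: "J \<subseteq> K \<Longrightarrow> killed i K \<subseteq> killed i J"
  by (auto simp: killed_def)

lemma killed_smult:
  assumes "J \<subseteq> carrier R" "e \<in> killed i J" "a \<in> carrier R"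
  shows "a \<odot>\<^bsub>E i\<^esub> e \<in> killed i (ideal_quotient R J {a})"
  using assms by (auto simp: killed_def ideal_quotient_def E.smult_assoc1[symmetric])

text \<open>
  The exact sequence \<open>0 \<rightarrow> R / (J : a) \<rightarrow> R / J \<rightarrow> R / (J + a R) \<rightarrow> 0\<close>, whose first map is multiplication
  by \<open>a\<close>, is what relates different cyclic modules.  It stays exact under homomorphisms into the
  injective module \<open>E i\<close>; the nontrivial part is that a homomorphism from \<open>R / (J : a)\<close> extends to
  \<open>R / J\<close>, which is Baer's property for the ideal \<open>J + a R\<close>.
\<close>

lemma killed_lift:
  assumes J: "ideal J R" and a: "a \<in> carrier R" and e: "e \<in> killed i (ideal_quotient R J {a})"
  obtains e' where "e' \<in> killed i J" "a \<odot>\<^bsub>E i\<^esub> e' = e"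
proof -
  note Js = ideal_simps[OF J]
  note K = ideal_adjoin[OF J a]
  have ec: "e \<in> carrier (E i)" using e by (rule killed_carrier)
  let ?K = "J <+>\<^bsub>R\<^esub> PIdl a"
  define f where "f c = (SOME r. r \<in> carrier R \<and> (\<exists>b\<in>J. c = b \<oplus> r \<otimes> a)) \<odot>\<^bsub>E i\<^esub> e" for c
  have f: "f c = r \<odot>\<^bsub>E i\<^esub> e" if br: "b \<in> J" "r \<in> carrier R" "c = b \<oplus> r \<otimes> a" for b r c
  proof -
    \<comment> \<open>\<open>s\<close> is the coefficient chosen by \<open>f\<close>; it differs from \<open>r\<close> by an element of \<open>J : a\<close>, which kills \<open>e\<close>.\<close>
    define s where "s = (SOME r. r \<in> carrier R \<and> (\<exists>b\<in>J. c = b \<oplus> r \<otimes> a))"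
    have "s \<in> carrier R \<and> (\<exists>b\<in>J. c = b \<oplus> s \<otimes> a)"
      unfolding s_def by (rule someI[of _ r]) (use br in blast)
    then obtain b' where s: "s \<in> carrier R" "b' \<in> J" "c = b' \<oplus> s \<otimes> a" by blast
    have c: "b \<in> carrier R" "b' \<in> carrier R" using br s Js(1) by auto
    have "(s \<ominus> r) \<otimes> a = (b' \<oplus> s \<otimes> a) \<ominus> (b \<oplus> r \<otimes> a) \<oplus> (b \<ominus> b')"
      using c br(2) s(1) a by algebra
    also have "\<dots> = b \<ominus> b'"
      unfolding s(3)[symmetric] br(3)[symmetric]
      using br c s a by (simp add: r_right_minus_eq)
    finally have "s \<ominus> r \<in> ideal_quotient R J {a}"
      using Js(6)[OF br(1) s(2)] br(2) s(1) by (simp add: ideal_quotient_def)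
    then have z: "(s \<ominus> r) \<odot>\<^bsub>E i\<^esub> e = \<zero>\<^bsub>E i\<^esub>" using e by (simp add: killed_def)
    have "s = (s \<ominus> r) \<oplus> r" using s(1) br(2) by algebra
    then have "s \<odot>\<^bsub>E i\<^esub> e = (s \<ominus> r) \<odot>\<^bsub>E i\<^esub> e \<oplus>\<^bsub>E i\<^esub> r \<odot>\<^bsub>E i\<^esub> e"
      using E.smult_l_distr[of "s \<ominus> r" r e i] s(1) br(2) ec by simp
    then show ?thesis unfolding f_def s_def[symmetric] z using br(2) ec by simp
  qed
  obtain e' where e': "e' \<in> carrier (E i)" "\<And>c. c \<in> ?K \<Longrightarrow> c \<odot>\<^bsub>E i\<^esub> e' = f c"
  proof (rule baer_property[OF injective_E K(1), where f = f])
    fix c assume "c \<in> ?K"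
    then obtain b r where br: "b \<in> J" "r \<in> carrier R" "c = b \<oplus> r \<otimes> a" unfolding K(2) by blast
    then show "f c \<in> carrier (E i)" using f[OF br] ec by simp
    fix c' assume "c' \<in> ?K"
    then obtain b' r' where br': "b' \<in> J" "r' \<in> carrier R" "c' = b' \<oplus> r' \<otimes> a" unfolding K(2) by blast
    have "c \<oplus> c' = (b \<oplus> b') \<oplus> (r \<oplus> r') \<otimes> a"
      unfolding br(3) br'(3) using Js(1)[OF br(1)] Js(1)[OF br'(1)] br(2) br'(2) a by algebra
    then have "f (c \<oplus> c') = (r \<oplus> r') \<odot>\<^bsub>E i\<^esub> e"
      using f[OF Js(3)[OF br(1) br'(1)] a_closed[OF br(2) br'(2)]] by blast
    then show "f (c \<oplus> c') = f c \<oplus>\<^bsub>E i\<^esub> f c'"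
      using f[OF br] f[OF br'] E.smult_l_distr[OF br(2) br'(2) ec] by simp
  next
    fix s c assume s: "s \<in> carrier R" and "c \<in> ?K"
    then obtain b r where br: "b \<in> J" "r \<in> carrier R" "c = b \<oplus> r \<otimes> a" unfolding K(2) by blast
    have "s \<otimes> c = s \<otimes> b \<oplus> (s \<otimes> r) \<otimes> a"
      unfolding br(3) using Js(1)[OF br(1)] br(2) s a by algebra
    then have "f (s \<otimes> c) = (s \<otimes> r) \<odot>\<^bsub>E i\<^esub> e"
      using f[OF Js(4)[OF br(1) s] m_closed[OF s br(2)]] by blast
    then show "f (s \<otimes> c) = s \<odot>\<^bsub>E i\<^esub> f c"
      using f[OF br] E.smult_assoc1[OF s br(2) ec] by simp
  qed blast
  show thesis
  proof (rule that)
    have "b \<odot>\<^bsub>E i\<^esub> e' = \<zero>\<^bsub>E i\<^esub>" if b: "b \<in> J" for b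
    proof -
      have "b = b \<oplus> \<zero> \<otimes> a" using Js(1)[OF b] a by simp
      then have "f b = \<zero> \<odot>\<^bsub>E i\<^esub> e" by (rule f[OF b zero_closed])
      then show ?thesis using e'(2)[of b] K(3) b ec by auto
    qed
    then show "e' \<in> killed i J" using e'(1) by (simp add: killed_def)
    have "a = \<zero> \<oplus> \<one> \<otimes> a" using a by simp
    then have "f a = \<one> \<odot>\<^bsub>E i\<^esub> e" by (rule f[OF Js(2) one_closed])
    then show "a \<odot>\<^bsub>E i\<^esub> e' = e" using e'(2)[OF K(4)] ec by simp
  qed
qed

lemma killed_adjoin:
  assumes J: "ideal J R" and a: "a \<in> carrier R" and e: "e \<in> killed i J" "a \<odot>\<^bsub>E i\<^esub> e = \<zero>\<^bsub>E i\<^esub>"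
  shows "e \<in> killed i (J <+>\<^bsub>R\<^esub> PIdl a)"
proof -
  note Js = ideal_simps[OF J]
  have ec: "e \<in> carrier (E i)" using e(1) by (rule killed_carrier)
  have "c \<odot>\<^bsub>E i\<^esub> e = \<zero>\<^bsub>E i\<^esub>" if "c \<in> J <+>\<^bsub>R\<^esub> PIdl a" for c
  proof -
    from that obtain b r where br: "b \<in> J" "r \<in> carrier R" "c = b \<oplus> r \<otimes> a"
      unfolding ideal_adjoin(2)[OF J a] by blast
    have "c \<odot>\<^bsub>E i\<^esub> e = b \<odot>\<^bsub>E i\<^esub> e \<oplus>\<^bsub>E i\<^esub> r \<odot>\<^bsub>E i\<^esub> (a \<odot>\<^bsub>E i\<^esub> e)"
      unfolding br(3) using Js(1)[OF br(1)] br(2) a ec by (simp add: E.smult_l_distr E.smult_assoc1)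
    then show ?thesis using e br(1,2) by (simp add: killed_def)
  qed
  then show ?thesis using ec by (simp add: killed_def)
qed

text \<open>Exactness of \<open>Ext(R / (J + a R)) \<rightarrow> Ext(R / J) \<rightarrow> Ext(R / (J : a))\<close> in the middle.\<close>

lemma ext_zero_extension:
  assumes J: "ideal J R" and a: "a \<in> carrier R"
    and "ext_zero i (J <+>\<^bsub>R\<^esub> PIdl a)" "ext_zero i (ideal_quotient R J {a})"
  shows "ext_zero i J"
  unfolding ext_zero_def
proof (intro ballI impI)
  fix z assume z: "z \<in> killed (Suc i) J" "d (Suc i) z = \<zero>\<^bsub>E (Suc (Suc i))\<^esub>"
  note Jc = ideal_simps(1)[OF J]
  have sub: "J \<subseteq> carrier R" using Jc by blast
  have zc: "z \<in> carrier (E (Suc i))" using z(1) by (rule killed_carrier)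
  have "a \<odot>\<^bsub>E (Suc i)\<^esub> z \<in> killed (Suc i) (ideal_quotient R J {a})"
    using killed_smult[OF sub z(1) a] .
  moreover have "d (Suc i) (a \<odot>\<^bsub>E (Suc i)\<^esub> z) = \<zero>\<^bsub>E (Suc (Suc i))\<^esub>"
    using d_smult[OF a zc] z(2) a by simp
  ultimately obtain w where w: "w \<in> killed i (ideal_quotient R J {a})" "a \<odot>\<^bsub>E (Suc i)\<^esub> z = d i w"
    using assms(4) unfolding ext_zero_def by blast
  obtain w' where w': "w' \<in> killed i J" "a \<odot>\<^bsub>E i\<^esub> w' = w" using killed_lift[OF J a w(1)] .
  have w'c: "w' \<in> carrier (E i)" using w'(1) by (rule killed_carrier)
  let ?y = "z \<ominus>\<^bsub>E (Suc i)\<^esub> d i w'"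
  have "?y \<in> killed (Suc i) J" using killed_minus[OF sub z(1) d_killed[OF sub w'(1)]] .
  moreover have "a \<odot>\<^bsub>E (Suc i)\<^esub> ?y = a \<odot>\<^bsub>E (Suc i)\<^esub> z \<ominus>\<^bsub>E (Suc i)\<^esub> a \<odot>\<^bsub>E (Suc i)\<^esub> d i w'"
    using a zc d_closed[OF w'c] by (simp add: a_minus_def E.smult_r_distr E.smult_r_minus)
  then have "a \<odot>\<^bsub>E (Suc i)\<^esub> ?y = \<zero>\<^bsub>E (Suc i)\<^esub>"
    using w(2) w'(2) d_smult[OF a w'c] d_closed[OF killed_carrier[OF w(1)]]
    by (simp add: a_minus_def E.r_neg)
  ultimately have "?y \<in> killed (Suc i) (J <+>\<^bsub>R\<^esub> PIdl a)" by (rule killed_adjoin[OF J a])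
  moreover have "d (Suc i) ?y = \<zero>\<^bsub>E (Suc (Suc i))\<^esub>"
    using d_minus[OF zc d_closed[OF w'c]] z(2) d_d[OF w'c] by (simp add: a_minus_def)
  ultimately obtain v where v: "v \<in> killed i (J <+>\<^bsub>R\<^esub> PIdl a)" "?y = d i v"
    using assms(3) unfolding ext_zero_def by blast
  have vJ: "v \<in> killed i J" using v(1) killed_antimono[OF ideal_adjoin(3)[OF J a]] by blast
  have "d i (v \<oplus>\<^bsub>E i\<^esub> w') = ?y \<oplus>\<^bsub>E (Suc i)\<^esub> d i w'"
    unfolding v(2) by (rule d_add[OF killed_carrier[OF vJ] w'c])
  also have "\<dots> = z" using zc d_closed[OF w'c] by (simp add: a_minus_def E.a_assoc E.l_neg)
  finally show "z \<in> d i ` killed i J" using killed_add[OF sub vJ w'(1)] by blast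
qed

text \<open>
  The same long exact sequence shows that \<open>Ext\<^sup>i(R / J) \<rightarrow> Ext\<^sup>i(R / (J : a))\<close> is surjective when
  \<open>Ext\<^sup>i\<^sup>+\<^sup>1(R / (J + a R))\<close> vanishes.  The surjectivity even holds for cocycles.
\<close>

lemma cocycle_lift:
  assumes J: "ideal J R" and a: "a \<in> carrier R" and ext: "ext_zero i (J <+>\<^bsub>R\<^esub> PIdl a)"
    and z: "z \<in> killed i (ideal_quotient R J {a})" "d i z = \<zero>\<^bsub>E (Suc i)\<^esub>"
  obtains z' where "z' \<in> killed i J" "d i z' = \<zero>\<^bsub>E (Suc i)\<^esub>" "a \<odot>\<^bsub>E i\<^esub> z' = z"
proof -
  have sub: "J \<subseteq> carrier R" using ideal_simps(1)[OF J] by blast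
  obtain y where y: "y \<in> killed i J" "a \<odot>\<^bsub>E i\<^esub> y = z" using killed_lift[OF J a z(1)] .
  have yc: "y \<in> carrier (E i)" using y(1) by (rule killed_carrier)
  have "d i y \<in> killed (Suc i) (J <+>\<^bsub>R\<^esub> PIdl a)"
    using killed_adjoin[OF J a d_killed[OF sub y(1)]] d_smult[OF a yc] y(2) z(2) by simp
  then obtain w where w: "w \<in> killed i (J <+>\<^bsub>R\<^esub> PIdl a)" "d i y = d i w"
    using ext d_d[OF yc] unfolding ext_zero_def by blast
  have wJ: "w \<in> killed i J" using w(1) killed_antimono[OF ideal_adjoin(3)[OF J a]] by blast
  have wc: "w \<in> carrier (E i)" using wJ by (rule killed_carrier)
  have wa: "a \<odot>\<^bsub>E i\<^esub> w = \<zero>\<^bsub>E i\<^esub>"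
    using w(1) ideal_adjoin(4)[OF J a] by (simp add: killed_def)
  show thesis
  proof (rule that)
    show "y \<ominus>\<^bsub>E i\<^esub> w \<in> killed i J" using killed_minus[OF sub y(1) wJ] .
    show "d i (y \<ominus>\<^bsub>E i\<^esub> w) = \<zero>\<^bsub>E (Suc i)\<^esub>"
      using d_minus[OF yc wc] w(2) d_closed[OF wc] by (simp add: a_minus_def E.r_neg)
    show "a \<odot>\<^bsub>E i\<^esub> (y \<ominus>\<^bsub>E i\<^esub> w) = z"
      using wa y a yc wc killed_carrier[OF z(1)]
      by (simp add: a_minus_def E.smult_r_distr E.smult_r_minus)
  qed
qed

end


section \<open>The double annihilator property modulo a regular element\<close>

context ring_resolution
begin

lemma killed_PIdl:
  assumes "x \<in> carrier R" "e \<in> carrier (E i)" "x \<odot>\<^bsub>E i\<^esub> e = \<zero>\<^bsub>E i\<^esub>"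
  shows "e \<in> killed i (PIdl x)"
  using assms by (auto simp: killed_def cgenideal_def E.smult_assoc1)

text \<open>Over a nonzerodivisor \<open>x\<close> this is the case \<open>0 : x = 0\<close> of the lifting property.\<close>

lemma divisible:
  assumes x: "x \<in> non_zerodivisors R" and v: "v \<in> carrier (E i)"
  obtains v' where "v' \<in> carrier (E i)" "x \<odot>\<^bsub>E i\<^esub> v' = v"
proof -
  have xc: "x \<in> carrier R" using x by (simp add: non_zerodivisors_def)
  have "ideal_quotient R {\<zero>} {x} = {\<zero>}"
  proof
    show "ideal_quotient R {\<zero>} {x} \<subseteq> {\<zero>}"
    proof
      fix r assume "r \<in> ideal_quotient R {\<zero>} {x}"
      then have "r \<in> carrier R" "x \<otimes> r = \<zero>" using m_comm[OF xc] by (auto simp: ideal_quotient_def)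
      then show "r \<in> {\<zero>}" using x by (simp add: non_zerodivisors_def)
    qed
  qed (use xc in \<open>simp add: ideal_quotient_def\<close>)
  then have "v \<in> killed i (ideal_quotient R {\<zero>} {x})" using v by (simp add: killed_def)
  then obtain v' where "v' \<in> killed i {\<zero>}" "x \<odot>\<^bsub>E i\<^esub> v' = v"
    by (rule killed_lift[OF zeroideal xc])
  then show thesis using that killed_carrier by blast
qed

text \<open>
  \<open>R / x R\<close> has the projective resolution \<open>0 \<rightarrow> R \<rightarrow> R \<rightarrow> R / x R \<rightarrow> 0\<close>, so its \<open>Ext\<^sup>i\<close> vanishes for \<open>i \<ge> 2\<close>.
\<close>

lemma ext_zero_principal:
  assumes x: "x \<in> non_zerodivisors R"
  shows "ext_zero (Suc i) (PIdl x)"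
  unfolding ext_zero_def
proof (intro ballI impI)
  fix z assume z: "z \<in> killed (Suc (Suc i)) (PIdl x)"
    "d (Suc (Suc i)) z = \<zero>\<^bsub>E (Suc (Suc (Suc i)))\<^esub>"
  have xc: "x \<in> carrier R" using x by (simp add: non_zerodivisors_def)
  have zc: "z \<in> carrier (E (Suc (Suc i)))" using z(1) by (rule killed_carrier)
  have xz: "x \<odot>\<^bsub>E (Suc (Suc i))\<^esub> z = \<zero>\<^bsub>E (Suc (Suc i))\<^esub>"
    using z(1) cgenideal_self[OF xc] by (simp add: killed_def)
  obtain w where w: "w \<in> carrier (E (Suc i))" "z = d (Suc i) w" using exact_Suc[OF zc z(2)] by blast
  have "d (Suc i) (x \<odot>\<^bsub>E (Suc i)\<^esub> w) = \<zero>\<^bsub>E (Suc (Suc i))\<^esub>" using d_smult[OF xc w(1)] xz w(2) by simp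
  then obtain v where v: "v \<in> carrier (E i)" "x \<odot>\<^bsub>E (Suc i)\<^esub> w = d i v"
    using exact_Suc[of "x \<odot>\<^bsub>E (Suc i)\<^esub> w" i] w(1) xc by auto
  obtain v' where v': "v' \<in> carrier (E i)" "x \<odot>\<^bsub>E i\<^esub> v' = v" using divisible[OF x v(1)] .
  let ?y = "w \<ominus>\<^bsub>E (Suc i)\<^esub> d i v'"
  have "x \<odot>\<^bsub>E (Suc i)\<^esub> ?y = x \<odot>\<^bsub>E (Suc i)\<^esub> w \<ominus>\<^bsub>E (Suc i)\<^esub> x \<odot>\<^bsub>E (Suc i)\<^esub> d i v'"
    using xc w(1) d_closed[OF v'(1)] by (simp add: a_minus_def E.smult_r_distr E.smult_r_minus)
  also have "\<dots> = \<zero>\<^bsub>E (Suc i)\<^esub>"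
    unfolding v(2) d_smult[OF xc v'(1), symmetric] v'(2)
    using d_closed[OF v(1)] by (simp add: a_minus_def E.r_neg)
  finally have "?y \<in> killed (Suc i) (PIdl x)"
    using killed_PIdl[OF xc] w(1) d_closed[OF v'(1)] by simp
  moreover have "d (Suc i) ?y = z"
    using d_minus[OF w(1) d_closed[OF v'(1)]] d_d[OF v'(1)] w(2) zc by (simp add: a_minus_def)
  ultimately show "z \<in> d (Suc i) ` killed (Suc i) (PIdl x)" by blast
qed

text \<open>
  If \<open>x\<close> is not a unit, let \<open>P\<close> be the prime ideal containing \<open>x\<close>.  As \<open>R / P\<close> embeds into \<open>R / x R\<close>, where the higher
  \<open>Ext\<close> vanishes, right exactness of the last possibly nonvanishing \<open>Ext\<close> makes it vanish on \<open>R / P\<close>;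
  it then vanishes on all \<open>R / J\<close> with \<open>x \<in> J\<close>, as these are successive extensions of copies of \<open>R / P\<close>.
\<close>

lemma ext_zero_step:
  assumes noeth: "noetherian_ring R" and x: "x \<in> non_zerodivisors R"
    and unique: "\<And>P P'. primeideal P R \<Longrightarrow> primeideal P' R \<Longrightarrow> x \<in> P \<Longrightarrow> x \<in> P' \<Longrightarrow> P = P'"
    and higher: "\<And>J. ideal J R \<Longrightarrow> x \<in> J \<Longrightarrow> ext_zero (Suc (Suc i)) J"
    and "ideal J R" "x \<in> J"
  shows "ext_zero (Suc i) J"
proof (rule ccontr)
  let ?F = "{J. ideal J R \<and> x \<in> J \<and> \<not> ext_zero (Suc i) J}"
  assume "\<not> ext_zero (Suc i) J"
  then have "?F \<noteq> {}" using assms(5,6) by blast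
  moreover have "ideal I R" if "I \<in> ?F" for I using that by blast
  ultimately have "\<exists>M\<in>?F. \<forall>I\<in>?F. M \<subseteq> I \<longrightarrow> I = M"
    by (rule noetherian_ring.ideal_family_maximal[OF noeth])
  then obtain M where M: "ideal M R" "x \<in> M" "\<not> ext_zero (Suc i) M"
    and max: "\<And>I. ideal I R \<Longrightarrow> x \<in> I \<Longrightarrow> M \<subseteq> I \<Longrightarrow> I \<noteq> M \<Longrightarrow> ext_zero (Suc i) I" by blast
  have xc: "x \<in> carrier R" using x by (simp add: non_zerodivisors_def)
  note X = cgenideal_ideal[OF xc] and Xsub = cgenideal_minimal[OF M(1,2)]
  have "killed j (carrier R) = {\<zero>\<^bsub>E j\<^esub>}" for j
  proof -
    have "e = \<zero>\<^bsub>E j\<^esub>" if e: "e \<in> killed j (carrier R)" for e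
    proof -
      have "\<one> \<odot>\<^bsub>E j\<^esub> e = \<zero>\<^bsub>E j\<^esub>" "e \<in> carrier (E j)" using e one_closed unfolding killed_def by blast+
      then show ?thesis by simp
    qed
    moreover have "\<zero>\<^bsub>E j\<^esub> \<in> killed j (carrier R)" by (simp add: killed_def)
    ultimately show ?thesis by blast
  qed
  then have "ext_zero (Suc i) (carrier R)" unfolding ext_zero_def by (simp add: d_zero)
  then have proper: "M \<noteq> carrier R" using M(3) by blast
  obtain a where a: "a \<in> carrier R" "a \<notin> M" "primeideal (ideal_quotient R M {a}) R"
    using associated_prime_exists[OF noeth M(1) proper] .
  have "PIdl x \<noteq> carrier R" using Xsub proper ideal_simps(1)[OF M(1)] by blast
  then obtain c where c: "c \<in> carrier R" "c \<notin> PIdl x" "primeideal (ideal_quotient R (PIdl x) {c}) R"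
    using associated_prime_exists[OF noeth X] by blast
  have "x \<in> ideal_quotient R M {a}" using ideal_quotient_superset[OF M(1), of "{a}"] M(2) a(1) by blast
  moreover have "x \<in> ideal_quotient R (PIdl x) {c}"
    using ideal_quotient_superset[OF X, of "{c}"] cgenideal_self[OF xc] c(1) by blast
  ultimately have eq: "ideal_quotient R M {a} = ideal_quotient R (PIdl x) {c}"
    by (rule unique[OF a(3) c(3)])
  have "ext_zero (Suc i) (ideal_quotient R (PIdl x) {c})"
    unfolding ext_zero_def
  proof (intro ballI impI)
    fix z assume z: "z \<in> killed (Suc (Suc i)) (ideal_quotient R (PIdl x) {c})"
      "d (Suc (Suc i)) z = \<zero>\<^bsub>E (Suc (Suc (Suc i)))\<^esub>"
    have "x \<in> PIdl x <+>\<^bsub>R\<^esub> PIdl c" using ideal_adjoin(3)[OF X c(1)] cgenideal_self[OF xc] by blast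
    then have "ext_zero (Suc (Suc i)) (PIdl x <+>\<^bsub>R\<^esub> PIdl c)"
      by (rule higher[OF ideal_adjoin(1)[OF X c(1)]])
    then obtain z' where z': "z' \<in> killed (Suc (Suc i)) (PIdl x)"
      "d (Suc (Suc i)) z' = \<zero>\<^bsub>E (Suc (Suc (Suc i)))\<^esub>" "c \<odot>\<^bsub>E (Suc (Suc i))\<^esub> z' = z"
      by (rule cocycle_lift[OF X c(1) _ z])
    then obtain w where w: "w \<in> killed (Suc i) (PIdl x)" "z' = d (Suc i) w"
      using ext_zero_principal[OF x, of i] unfolding ext_zero_def by blast
    have "z = d (Suc i) (c \<odot>\<^bsub>E (Suc i)\<^esub> w)"
      using d_smult[OF c(1) killed_carrier[OF w(1)]] z'(3) w(2) by simp
    moreover have "PIdl x \<subseteq> carrier R" using ideal_simps(1)[OF X] by blast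
    note killed_smult[OF this w(1) c(1)]
    ultimately show "z \<in> d (Suc i) ` killed (Suc i) (ideal_quotient R (PIdl x) {c})" by blast
  qed
  then have "ext_zero (Suc i) (ideal_quotient R M {a})" unfolding eq .
  moreover have "ext_zero (Suc i) (M <+>\<^bsub>R\<^esub> PIdl a)"
    using max[OF ideal_adjoin(1)[OF M(1) a(1)]] ideal_adjoin(3,4)[OF M(1) a(1)] M(2) a(2) by blast
  ultimately have "ext_zero (Suc i) M" using ext_zero_extension[OF M(1) a(1)] by blast
  then show False using M(3) by blast
qed

text \<open>Descending induction from the length \<open>n\<close> of the resolution; \<open>k\<close> is the distance still to go.\<close>

lemma ext_zero_from_finite:
  assumes noeth: "noetherian_ring R" and x: "x \<in> non_zerodivisors R"
    and unique: "\<And>P P'. primeideal P R \<Longrightarrow> primeideal P' R \<Longrightarrow> x \<in> P \<Longrightarrow> x \<in> P' \<Longrightarrow> P = P'"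
    and finite: "\<And>i. n < i \<Longrightarrow> carrier (E i) = {\<zero>\<^bsub>E i\<^esub>}"
    and "ideal J R" "x \<in> J"
  shows "ext_zero (Suc i) J"
proof -
  have "\<forall>J. ideal J R \<longrightarrow> x \<in> J \<longrightarrow> ext_zero (Suc i) J" if "n \<le> i + k" for i k
    using that
  proof (induction k arbitrary: i)
    case 0
    have "carrier (E (Suc (Suc i))) = {\<zero>\<^bsub>E (Suc (Suc i))\<^esub>}" by (rule finite) (use 0 in simp)
    moreover have "\<zero>\<^bsub>E (Suc i)\<^esub> \<in> killed (Suc i) J" if "ideal J R" for J
      using ideal_simps(1)[OF that] by (simp add: killed_def)
    ultimately have "z \<in> d (Suc i) ` killed (Suc i) J"
      if "ideal J R" "z \<in> killed (Suc (Suc i)) J" for J z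
      using that killed_carrier[OF that(2)] d_zero[of "Suc i"] by (intro image_eqI) auto
    then show ?case unfolding ext_zero_def by blast
  next
    case (Suc k)
    then have "\<forall>J. ideal J R \<longrightarrow> x \<in> J \<longrightarrow> ext_zero (Suc (Suc i)) J" by simp
    then show ?case using ext_zero_step[OF noeth x unique] by blast
  qed
  from this[of i n] show ?thesis using assms(5,6) by simp
qed

text \<open>
  The vanishing of \<open>Ext\<^sup>2\<close> makes \<open>Ext\<^sup>1(R / J, R) = Hom(R / J, R / x R)\<close> right exact, that is, \<open>R / x R\<close> is
  self-injective.  So a homomorphism from the submodule \<open>R / (J : a)\<close> of \<open>R / J\<close> generated by the class
  of \<open>a\<close> that does not kill this class extends to \<open>R / J\<close>; its value at \<open>1\<close> is annihilated by \<open>J\<close> but not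
  by \<open>a\<close>.  Such a homomorphism exists, since \<open>R / (J : a)\<close> maps onto \<open>R / P\<close>, which embeds into
  \<open>R / x R\<close>.  An element \<open>r\<close> of \<open>x R : J\<close> corresponds to the class in \<open>Ext\<^sup>1(R / J, R)\<close> of \<open>d e\<close>, where
  \<open>b e = b r / x\<close> for \<open>b \<in> J\<close>.
\<close>

theorem double_ideal_quotient_principal:
  assumes noeth: "noetherian_ring R" and x: "x \<in> non_zerodivisors R"
    and unique: "\<And>P P'. primeideal P R \<Longrightarrow> primeideal P' R \<Longrightarrow> x \<in> P \<Longrightarrow> x \<in> P' \<Longrightarrow> P = P'"
    and finite: "\<And>i. n < i \<Longrightarrow> carrier (E i) = {\<zero>\<^bsub>E i\<^esub>}"
    and J: "ideal J R" and xJ: "x \<in> J"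
  shows "ideal_quotient R (PIdl x) (ideal_quotient R (PIdl x) J) \<subseteq> J"
proof (rule subsetI, rule ccontr)
  fix a assume "a \<in> ideal_quotient R (PIdl x) (ideal_quotient R (PIdl x) J)" and aJ: "a \<notin> J"
  then have a: "a \<in> carrier R" and
    aq: "\<And>r. r \<in> ideal_quotient R (PIdl x) J \<Longrightarrow> a \<otimes> r \<in> PIdl x"
    unfolding ideal_quotient_def by auto
  have xc: "x \<in> carrier R" using x by (simp add: non_zerodivisors_def)
  note X = cgenideal_ideal[OF xc]
  note Js = ideal_simps[OF J]
  define K where "K = ideal_quotient R J {a}"
  have K: "ideal K R" unfolding K_def using ideal_ideal_quotient[OF J] a by simp
  note Ks = ideal_simps[OF K]
  have xK: "x \<in> K" unfolding K_def using ideal_quotient_superset[OF J, of "{a}"] xJ a by blast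
  have "K \<noteq> carrier R" unfolding K_def by (rule proper_ideal_quotient[OF a aJ])
  then obtain u where u: "u \<in> carrier R" "primeideal (ideal_quotient R K {u}) R"
    using associated_prime_exists[OF noeth K] by blast
  have "PIdl x \<noteq> carrier R" using cgenideal_minimal[OF J xJ] a aJ by blast
  then obtain c where c: "c \<in> carrier R" "c \<notin> PIdl x" "primeideal (ideal_quotient R (PIdl x) {c}) R"
    using associated_prime_exists[OF noeth X] by blast
  have Ku: "K \<subseteq> ideal_quotient R K {u}" using ideal_quotient_superset[OF K] u(1) by simp
  have "x \<in> ideal_quotient R (PIdl x) {c}"
    using ideal_quotient_superset[OF X, of "{c}"] cgenideal_self[OF xc] c(1) by blast
  then have "ideal_quotient R K {u} = ideal_quotient R (PIdl x) {c}"
    using unique[OF u(2) c(3)] Ku xK by blast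
  then have Kc: "b \<otimes> c \<in> PIdl x" if "b \<in> K" for b using Ku that unfolding ideal_quotient_def by auto
  \<comment> \<open>\<open>q b = b c / x\<close>, so that \<open>b \<mapsto> q b\<close> represents the homomorphism \<open>R / K \<rightarrow> R / x R\<close> with value \<open>c\<close> at \<open>1\<close>.\<close>
  define q where "q b = (SOME s. s \<in> carrier R \<and> b \<otimes> c = x \<otimes> s)" for b
  have q: "q b \<in> carrier R" "b \<otimes> c = x \<otimes> q b" if "b \<in> K" for b
    using someI_ex[of "\<lambda>s. s \<in> carrier R \<and> b \<otimes> c = x \<otimes> s"] Kc[OF that]
    unfolding q_def mem_PIdl_iff[OF xc] by blast+
  have q_eq: "q b = s" if "b \<in> K" "s \<in> carrier R" "b \<otimes> c = x \<otimes> s" for b s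
    using nonzerodivisor_cancel[OF x q(1)[OF that(1)] that(2)] q(2)[OF that(1)] that(3) by simp
  obtain e where e: "e \<in> carrier (E 0)" "\<And>b. b \<in> K \<Longrightarrow> b \<odot>\<^bsub>E 0\<^esub> e = \<epsilon> (q b)"
  proof (rule baer_property[OF injective_E[of 0] K, where f = "\<lambda>b. \<epsilon> (q b)"])
    show "\<epsilon> (q b) \<in> carrier (E 0)" if "b \<in> K" for b using \<epsilon>_closed q(1)[OF that] .
    show "\<epsilon> (q (b \<oplus> b')) = \<epsilon> (q b) \<oplus>\<^bsub>E 0\<^esub> \<epsilon> (q b')" if "b \<in> K" "b' \<in> K" for b b'
    proof -
      have "(b \<oplus> b') \<otimes> c = x \<otimes> (q b \<oplus> q b')"
        using q[OF that(1)] q[OF that(2)] Ks(1)[OF that(1)] Ks(1)[OF that(2)] c(1) xc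
        by (simp add: l_distr r_distr)
      then have "q (b \<oplus> b') = q b \<oplus> q b'"
        using q_eq Ks(3)[OF that] q(1)[OF that(1)] q(1)[OF that(2)] by simp
      then show ?thesis using \<epsilon>_add q(1)[OF that(1)] q(1)[OF that(2)] by simp
    qed
    show "\<epsilon> (q (r \<otimes> b)) = r \<odot>\<^bsub>E 0\<^esub> \<epsilon> (q b)" if "r \<in> carrier R" "b \<in> K" for r b
    proof -
      have "(r \<otimes> b) \<otimes> c = r \<otimes> (x \<otimes> q b)"
        using q(2)[OF that(2)] Ks(1)[OF that(2)] that(1) c(1) by (simp add: m_assoc)
      also have "\<dots> = x \<otimes> (r \<otimes> q b)" using that(1) xc q(1)[OF that(2)] by (simp add: m_lcomm)
      finally have "q (r \<otimes> b) = r \<otimes> q b"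
        using q_eq Ks(4)[OF that(2,1)] q(1)[OF that(2)] that(1) by simp
      then show ?thesis using \<epsilon>_mult that(1) q(1)[OF that(2)] by simp
    qed
  qed blast
  have qx: "q x = c" by (rule q_eq[OF xK c(1)]) simp
  have "b \<odot>\<^bsub>E 1\<^esub> d 0 e = \<zero>\<^bsub>E 1\<^esub>" if "b \<in> K" for b
    using d_smult[OF Ks(1)[OF that] e(1)] e(2)[OF that] d_\<epsilon> q(1)[OF that] by simp
  then have z: "d 0 e \<in> killed (Suc 0) (ideal_quotient R J {a})"
    using d_closed[OF e(1)] unfolding killed_def K_def by simp
  have "x \<in> J <+>\<^bsub>R\<^esub> PIdl a" using ideal_adjoin(3)[OF J a] xJ by blast
  then have "ext_zero (Suc 0) (J <+>\<^bsub>R\<^esub> PIdl a)"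
    using ext_zero_from_finite[OF noeth x, where n = n and i = 0] unique finite
      ideal_adjoin(1)[OF J a] by blast
  then obtain z' where z': "z' \<in> killed (Suc 0) J" "d (Suc 0) z' = \<zero>\<^bsub>E (Suc (Suc 0))\<^esub>"
    "a \<odot>\<^bsub>E (Suc 0)\<^esub> z' = d 0 e"
    by (rule cocycle_lift[OF J a _ z d_d[OF e(1)]])
  obtain e' where e': "e' \<in> carrier (E 0)" "z' = d 0 e'"
    using exact_Suc[OF killed_carrier[OF z'(1)] z'(2)] by blast
  have lift: "\<exists>s\<in>carrier R. b \<odot>\<^bsub>E 0\<^esub> e' = \<epsilon> s" if "b \<in> J" for b
  proof (rule exact_0)
    show "b \<odot>\<^bsub>E 0\<^esub> e' \<in> carrier (E 0)" using Js(1)[OF that] e'(1) by simp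
    show "d 0 (b \<odot>\<^bsub>E 0\<^esub> e') = \<zero>\<^bsub>E 1\<^esub>"
      using d_smult[OF Js(1)[OF that] e'(1)] z'(1) that unfolding e'(2) killed_def by simp
  qed
  \<comment> \<open>\<open>r\<close> is the value at \<open>1\<close> of the homomorphism \<open>R / J \<rightarrow> R / x R\<close> that corresponds to \<open>z'\<close>.\<close>
  obtain r where r: "r \<in> carrier R" "x \<odot>\<^bsub>E 0\<^esub> e' = \<epsilon> r" using lift[OF xJ] by blast
  have "r \<in> ideal_quotient R (PIdl x) J"
    unfolding ideal_quotient_def
  proof (intro CollectI conjI ballI r(1))
    fix b assume b: "b \<in> J"
    then obtain s where s: "s \<in> carrier R" "b \<odot>\<^bsub>E 0\<^esub> e' = \<epsilon> s" using lift by blast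
    have "\<epsilon> (b \<otimes> r) = (b \<otimes> x) \<odot>\<^bsub>E 0\<^esub> e'"
      using \<epsilon>_mult Js(1)[OF b] r xc e'(1) by (simp add: E.smult_assoc1)
    also have "\<dots> = \<epsilon> (x \<otimes> s)"
      using \<epsilon>_mult Js(1)[OF b] s xc e'(1) by (simp add: E.smult_assoc1 m_comm[of b])
    finally have "b \<otimes> r = x \<otimes> s" using \<epsilon>_inj Js(1)[OF b] r(1) s(1) xc by simp
    then show "r \<otimes> b \<in> PIdl x"
      unfolding mem_PIdl_iff[OF xc] using m_comm[OF r(1) Js(1)[OF b]] s(1) by auto
  qed
  then have ar: "a \<otimes> r \<in> PIdl x" by (rule aq)
  have ae: "a \<odot>\<^bsub>E 0\<^esub> e' \<ominus>\<^bsub>E 0\<^esub> e \<in> carrier (E 0)" using a e e'(1) by simp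
  have "d 0 (a \<odot>\<^bsub>E 0\<^esub> e' \<ominus>\<^bsub>E 0\<^esub> e) = \<zero>\<^bsub>E 1\<^esub>"
    using d_minus[of "a \<odot>\<^bsub>E 0\<^esub> e'" 0 e] d_smult[OF a e'(1)] z'(3) e'(2) a e(1) e'(1) d_closed[OF e(1)]
    by (simp add: a_minus_def E.r_neg)
  then obtain t where t: "t \<in> carrier R" "a \<odot>\<^bsub>E 0\<^esub> e' \<ominus>\<^bsub>E 0\<^esub> e = \<epsilon> t" using exact_0[OF ae] by blast
  have "\<epsilon> (x \<otimes> t) = x \<odot>\<^bsub>E 0\<^esub> (a \<odot>\<^bsub>E 0\<^esub> e' \<ominus>\<^bsub>E 0\<^esub> e)" using \<epsilon>_mult xc t by simp
  also have "\<dots> = (a \<otimes> x) \<odot>\<^bsub>E 0\<^esub> e' \<ominus>\<^bsub>E 0\<^esub> x \<odot>\<^bsub>E 0\<^esub> e"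
    using a xc e(1) e'(1)
    by (simp add: a_minus_def E.smult_r_distr E.smult_r_minus E.smult_assoc1[symmetric] m_comm[of a])
  also have "\<dots> = \<epsilon> (a \<otimes> r \<ominus> c)"
    using e(2)[OF xK] qx a r xc c(1) e'(1) \<epsilon>_mult \<epsilon>_minus by (simp add: E.smult_assoc1)
  finally have "x \<otimes> t = a \<otimes> r \<ominus> c" using \<epsilon>_inj xc t(1) a r(1) c(1) by simp
  then have "c = a \<otimes> r \<ominus> x \<otimes> t" using xc t(1) a r(1) c(1) by (simp, algebra)
  moreover have "x \<otimes> t \<in> PIdl x" unfolding mem_PIdl_iff[OF xc] using t(1) by blast
  ultimately have "c \<in> PIdl x" using ideal_simps(6)[OF X ar] by simp
  then show False using c(2) by blast
qed

end

section \<open>Ideals of localizations\<close>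

definition extended_ideal :: "('a, 'x) ring_scheme \<Rightarrow> 'a set \<Rightarrow> 'a set \<Rightarrow> ('a \<times> 'a) set set" where
  "extended_ideal R S I = {fraction R S b s | b s. b \<in> I \<and> s \<in> S}"

definition contracted_ideal :: "('a, 'x) ring_scheme \<Rightarrow> 'a set \<Rightarrow> ('a \<times> 'a) set set \<Rightarrow> 'a set" where
  "contracted_ideal R S K = {r \<in> carrier R. fraction R S r \<one>\<^bsub>R\<^esub> \<in> K}"

context
  fixes R :: "('a, 'x) ring_scheme" (structure) and S
  assumes R: "cring R" and S: "submonoid S R"
begin

interpretation cring R by (rule R)

interpretation L: cring "localization R S" by (rule localization_cring[OF R S])

private lemmas Sc = mult_set_simps[OF R S]
private lemmas fr_closed = fraction_closed[OF R S]
private lemmas fr_mult = localization_mult[OF R S]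
private lemmas fr_add = localization_add[OF R S]
private lemmas fr_eq_iff = fraction_eq_iff[OF R S]
private lemmas fr_eqI = fraction_eqI[OF R S]
private lemmas fr_carrierE = localization_carrierE[OF R S]

lemma fraction_mem_extended_ideal_iff:
  assumes I: "ideal I R" and "r \<in> carrier R" "s \<in> S"
  shows "fraction R S r s \<in> extended_ideal R S I \<longleftrightarrow> (\<exists>t\<in>S. t \<otimes> r \<in> I)"
proof
  note Is = ideal_simps[OF I]
  assume "fraction R S r s \<in> extended_ideal R S I"
  then obtain b u where b: "b \<in> I" "u \<in> S" "fraction R S r s = fraction R S b u"
    unfolding extended_ideal_def by blast
  then obtain t where t: "t \<in> S" "t \<otimes> (u \<otimes> r) = t \<otimes> (s \<otimes> b)"
    using fr_eq_iff[OF assms(2) Is(1)[OF b(1)] assms(3) b(2)] by blast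
  have "t \<otimes> u \<otimes> r = t \<otimes> s \<otimes> b"
    using t Sc(1) assms(2,3) b(1,2) Is(1)[OF b(1)] by (simp add: m_assoc)
  also have "\<dots> \<in> I" using Is(4)[OF b(1)] Sc(1) t(1) assms(3) by simp
  finally show "\<exists>t\<in>S. t \<otimes> r \<in> I" using Sc(3)[OF t(1) b(2)] by blast
next
  assume "\<exists>t\<in>S. t \<otimes> r \<in> I"
  then obtain t where t: "t \<in> S" "t \<otimes> r \<in> I" by blast
  have "fraction R S r s = fraction R S (t \<otimes> r) (t \<otimes> s)"
    by (rule fr_eqI) (use Sc assms t in \<open>auto simp: m_ac\<close>)
  then show "fraction R S r s \<in> extended_ideal R S I"
    unfolding extended_ideal_def using t(2) Sc(3)[OF t(1) assms(3)] by blast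
qed

lemma ideal_extended_ideal:
  assumes I: "ideal I R"
  shows "ideal (extended_ideal R S I) (localization R S)"
proof (rule L.ideal_of_closed)
  note Is = ideal_simps[OF I]
  show "extended_ideal R S I \<subseteq> carrier (localization R S)"
    using Is(1) fr_closed by (auto simp: extended_ideal_def)
  show "\<zero>\<^bsub>localization R S\<^esub> \<in> extended_ideal R S I"
    unfolding localization_zero[OF R S] extended_ideal_def using Is(2) Sc(2) by blast
next
  note Is = ideal_simps[OF I]
  fix p q assume "p \<in> extended_ideal R S I" "q \<in> extended_ideal R S I"
  then obtain a s b t where p: "a \<in> I" "s \<in> S" "p = fraction R S a s"
    and q: "b \<in> I" "t \<in> S" "q = fraction R S b t" unfolding extended_ideal_def by blast
  have "p \<oplus>\<^bsub>localization R S\<^esub> q = fraction R S (t \<otimes> a \<oplus> s \<otimes> b) (s \<otimes> t)"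
    unfolding p(3) q(3) by (rule fr_add) (use p q Is(1) in auto)
  moreover have "t \<otimes> a \<oplus> s \<otimes> b \<in> I" using Is(3)[OF Is(4)[OF p(1) Sc(1)[OF q(2)]] Is(4)[OF q(1) Sc(1)[OF p(2)]]] .
  ultimately show "p \<oplus>\<^bsub>localization R S\<^esub> q \<in> extended_ideal R S I"
    unfolding extended_ideal_def using Sc(3)[OF p(2) q(2)] by blast
next
  note Is = ideal_simps[OF I]
  fix p q assume "p \<in> extended_ideal R S I" "q \<in> carrier (localization R S)"
  then obtain a s where p: "a \<in> I" "s \<in> S" "p = fraction R S a s" unfolding extended_ideal_def by blast
  obtain b t where q: "b \<in> carrier R" "t \<in> S" "q = fraction R S b t"
    using \<open>q \<in> carrier (localization R S)\<close> by (rule fr_carrierE)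
  have "q \<otimes>\<^bsub>localization R S\<^esub> p = fraction R S (b \<otimes> a) (t \<otimes> s)"
    unfolding p(3) q(3) by (rule fr_mult) (use p q Is(1) in auto)
  moreover have "b \<otimes> a \<in> I" using Is(4)[OF p(1) q(1)] .
  ultimately show "q \<otimes>\<^bsub>localization R S\<^esub> p \<in> extended_ideal R S I"
    unfolding extended_ideal_def using Sc(3)[OF q(2) p(2)] by blast
qed

lemma fraction_mem_ideal_iff:
  assumes K: "ideal K (localization R S)" and r: "r \<in> carrier R" and s: "s \<in> S"
  shows "fraction R S r s \<in> K \<longleftrightarrow> r \<in> contracted_ideal R S K"
proof
  assume m: "fraction R S r s \<in> K"
  have "fraction R S s \<one> \<otimes>\<^bsub>localization R S\<^esub> fraction R S r s = fraction R S (s \<otimes> r) (\<one> \<otimes> s)"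
    by (rule fr_mult) (use r s Sc in auto)
  also have "\<dots> = fraction R S r \<one>" by (rule fr_eqI) (use r s Sc in auto)
  finally show "r \<in> contracted_ideal R S K"
    unfolding contracted_ideal_def using ideal_simps(4)[OF K m fr_closed[OF Sc(1)[OF s] Sc(2)]] r by simp
next
  assume "r \<in> contracted_ideal R S K"
  then have m: "fraction R S r \<one> \<in> K" by (simp add: contracted_ideal_def)
  have "fraction R S \<one> s \<otimes>\<^bsub>localization R S\<^esub> fraction R S r \<one> = fraction R S (\<one> \<otimes> r) (s \<otimes> \<one>)"
    by (rule fr_mult) (use r s Sc in auto)
  also have "\<dots> = fraction R S r s" by (rule fr_eqI) (use r s Sc in auto)
  finally show "fraction R S r s \<in> K"
    using ideal_simps(4)[OF K m fr_closed[OF one_closed s]] by simp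
qed

lemma ideal_contracted_ideal:
  assumes K: "ideal K (localization R S)"
  shows "ideal (contracted_ideal R S K) R"
proof (rule ideal_of_closed)
  note Ks = ideal_simps[OF K]
  show "contracted_ideal R S K \<subseteq> carrier R" by (auto simp: contracted_ideal_def)
  show "\<zero> \<in> contracted_ideal R S K"
    using Ks(2) by (simp add: contracted_ideal_def localization_zero[OF R S])
  show "a \<oplus> b \<in> contracted_ideal R S K"
    if "a \<in> contracted_ideal R S K" "b \<in> contracted_ideal R S K" for a b
  proof -
    have m: "a \<in> carrier R" "b \<in> carrier R" "fraction R S a \<one> \<in> K" "fraction R S b \<one> \<in> K"
      using that by (auto simp: contracted_ideal_def)
    have "fraction R S a \<one> \<oplus>\<^bsub>localization R S\<^esub> fraction R S b \<one> =
        fraction R S (\<one> \<otimes> a \<oplus> \<one> \<otimes> b) (\<one> \<otimes> \<one>)"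
      by (rule fr_add) (use m Sc in auto)
    then show ?thesis using Ks(3)[OF m(3,4)] m(1,2) by (simp add: contracted_ideal_def)
  qed
  show "r \<otimes> a \<in> contracted_ideal R S K"
    if "a \<in> contracted_ideal R S K" "r \<in> carrier R" for a r
  proof -
    have m: "a \<in> carrier R" "fraction R S a \<one> \<in> K" using that(1) by (auto simp: contracted_ideal_def)
    have "fraction R S r \<one> \<otimes>\<^bsub>localization R S\<^esub> fraction R S a \<one> = fraction R S (r \<otimes> a) (\<one> \<otimes> \<one>)"
      by (rule fr_mult) (use m that(2) Sc in auto)
    then show ?thesis
      using Ks(4)[OF m(2) fr_closed[OF that(2) Sc(2)]] m(1) that(2) by (simp add: contracted_ideal_def)
  qed
qed

lemma contracted_ideal_subset_imp_subset:
  assumes K: "ideal K (localization R S)" and K': "ideal K' (localization R S)"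
    and sub: "contracted_ideal R S K \<subseteq> contracted_ideal R S K'"
  shows "K \<subseteq> K'"
proof
  fix q assume q: "q \<in> K"
  obtain r s where "r \<in> carrier R" "s \<in> S" "q = fraction R S r s"
    by (rule fr_carrierE[OF ideal_simps(1)[OF K q]])
  then show "q \<in> K'" using q sub fraction_mem_ideal_iff[OF K] fraction_mem_ideal_iff[OF K'] by auto
qed

lemma noetherian_localization:
  assumes "noetherian_ring R"
  shows "noetherian_ring (localization R S)"
proof (rule L.noetherian_ringI)
  fix K assume K: "ideal K (localization R S)"
  note C = ideal_contracted_ideal[OF K]
  obtain A where A: "A \<subseteq> carrier R" "finite A" "contracted_ideal R S K = Idl A"
    using noetherian_ring.finetely_gen[OF assms C] by blast
  let ?B = "(\<lambda>r. fraction R S r \<one>) ` A"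
  have B: "?B \<subseteq> carrier (localization R S)" using A(1) fr_closed Sc(2) by auto
  note G = L.genideal_ideal[OF B]
  have "?B \<subseteq> K" using genideal_self[OF A(1)] A(3) by (auto simp: contracted_ideal_def)
  then have "Idl\<^bsub>localization R S\<^esub> ?B \<subseteq> K" by (rule L.genideal_minimal[OF K])
  moreover have "A \<subseteq> contracted_ideal R S (Idl\<^bsub>localization R S\<^esub> ?B)"
    using L.genideal_self[OF B] A(1) by (auto simp: contracted_ideal_def)
  then have "contracted_ideal R S K \<subseteq> contracted_ideal R S (Idl\<^bsub>localization R S\<^esub> ?B)"
    unfolding A(3) by (rule genideal_minimal[OF ideal_contracted_ideal[OF G]])
  then have "K \<subseteq> Idl\<^bsub>localization R S\<^esub> ?B" by (rule contracted_ideal_subset_imp_subset[OF K G])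
  ultimately show "\<exists>B\<subseteq>carrier (localization R S). finite B \<and> K = Idl\<^bsub>localization R S\<^esub> B"
    using B A(2) by (intro exI[of _ ?B]) auto
qed

lemma primeideal_contracted_ideal:
  assumes "primeideal K (localization R S)"
  shows "primeideal (contracted_ideal R S K) R" "contracted_ideal R S K \<inter> S = {}"
proof -
  interpret K: primeideal K "localization R S" by (rule assms)
  note K = K.is_ideal
  have one: "fraction R S \<one> \<one> \<notin> K"
    using K.I_notcarr K.one_imp_carrier unfolding localization_one[OF R S] by auto
  show disjoint: "contracted_ideal R S K \<inter> S = {}"
  proof (rule equals0I)
    fix s assume s: "s \<in> contracted_ideal R S K \<inter> S"
    then have "fraction R S s s \<in> K" using fraction_mem_ideal_iff[OF K] Sc(1) by blast
    moreover have "fraction R S s s = fraction R S \<one> \<one>"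
      by (rule fr_eqI) (use s Sc in auto)
    ultimately show False using one by simp
  qed
  show "primeideal (contracted_ideal R S K) R"
  proof (rule primeidealI[OF ideal_contracted_ideal[OF K] is_cring])
    show "carrier R \<noteq> contracted_ideal R S K" using disjoint Sc(2) one_closed by blast
    fix a b assume a: "a \<in> carrier R" and b: "b \<in> carrier R" and ab: "a \<otimes> b \<in> contracted_ideal R S K"
    have "fraction R S a \<one> \<otimes>\<^bsub>localization R S\<^esub> fraction R S b \<one> = fraction R S (a \<otimes> b) (\<one> \<otimes> \<one>)"
      by (rule fr_mult) (use a b Sc in auto)
    then have "fraction R S a \<one> \<otimes>\<^bsub>localization R S\<^esub> fraction R S b \<one> \<in> K"
      using ab by (simp add: contracted_ideal_def)
    then have "fraction R S a \<one> \<in> K \<or> fraction R S b \<one> \<in> K"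
      by (intro K.I_prime fr_closed a b Sc(2))
    then show "a \<in> contracted_ideal R S K \<or> b \<in> contracted_ideal R S K"
      using a b by (simp add: contracted_ideal_def)
  qed
qed

lemma fraction_non_zerodivisor:
  assumes x: "x \<in> non_zerodivisors R"
  shows "fraction R S x \<one> \<in> non_zerodivisors (localization R S)"
  unfolding non_zerodivisors_def
proof (intro CollectI conjI ballI impI)
  have xc: "x \<in> carrier R" using x by (simp add: non_zerodivisors_def)
  then show "fraction R S x \<one> \<in> carrier (localization R S)" using fr_closed Sc(2) by blast
  fix q assume "q \<in> carrier (localization R S)"
    and z: "fraction R S x \<one> \<otimes>\<^bsub>localization R S\<^esub> q = \<zero>\<^bsub>localization R S\<^esub>"
  then obtain r s where q: "r \<in> carrier R" "s \<in> S" "q = fraction R S r s" by (elim fr_carrierE)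
  note sc = Sc(1)[OF q(2)]
  have "fraction R S (x \<otimes> r) (\<one> \<otimes> s) = fraction R S \<zero> \<one>"
    using z fr_mult[OF xc q(1) Sc(2) q(2)] unfolding q(3) localization_zero[OF R S] by simp
  then obtain t where t: "t \<in> S" "t \<otimes> (\<one> \<otimes> (x \<otimes> r)) = t \<otimes> ((\<one> \<otimes> s) \<otimes> \<zero>)"
    using fr_eq_iff[of "x \<otimes> r" \<zero> "\<one> \<otimes> s" \<one>] xc q(1,2) sc Sc(2) by auto
  have "x \<otimes> (t \<otimes> r) = \<zero>" using t xc q(1) sc Sc(1)[OF t(1)] by (simp add: m_lcomm)
  then have tr: "t \<otimes> r = \<zero>" using x q(1) Sc(1)[OF t(1)] by (simp add: non_zerodivisors_def)
  have "t \<otimes> (\<one> \<otimes> r) = t \<otimes> (s \<otimes> \<zero>)" using tr q(1) sc Sc(1)[OF t(1)] by simp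
  then show "q = \<zero>\<^bsub>localization R S\<^esub>"
    unfolding q(3) localization_zero[OF R S] fr_eq_iff[OF q(1) zero_closed q(2) Sc(2)]
    using t(1) by blast
qed

lemma extended_PIdl:
  assumes x: "x \<in> carrier R"
  shows "extended_ideal R S (PIdl x) = PIdl\<^bsub>localization R S\<^esub> (fraction R S x \<one>)"
proof
  have xL: "fraction R S x \<one> \<in> carrier (localization R S)" using fr_closed[OF x Sc(2)] .
  show "PIdl\<^bsub>localization R S\<^esub> (fraction R S x \<one>) \<subseteq> extended_ideal R S (PIdl x)"
    by (rule L.cgenideal_minimal[OF ideal_extended_ideal[OF cgenideal_ideal[OF x]]])
      (use cgenideal_self[OF x] Sc(2) in \<open>auto simp: extended_ideal_def\<close>)
  show "extended_ideal R S (PIdl x) \<subseteq> PIdl\<^bsub>localization R S\<^esub> (fraction R S x \<one>)"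
  proof
    fix q assume "q \<in> extended_ideal R S (PIdl x)"
    then obtain b s where b: "b \<in> PIdl x" "s \<in> S" "q = fraction R S b s"
      unfolding extended_ideal_def by blast
    then obtain u where u: "u \<in> carrier R" "s \<in> S" "q = fraction R S (x \<otimes> u) s"
      using mem_PIdl_iff[OF x] by auto
    have "q = fraction R S x \<one> \<otimes>\<^bsub>localization R S\<^esub> fraction R S u s"
      using fr_mult[OF x u(1) Sc(2) u(2)] u Sc(1)[OF u(2)] by simp
    then show "q \<in> PIdl\<^bsub>localization R S\<^esub> (fraction R S x \<one>)"
      unfolding L.mem_PIdl_iff[OF xL] using fr_closed[OF u(1,2)] by blast
  qed
qed

end

text \<open>
  Noetherian induction replaces the product of the denominators of finitely many generators of \<open>J\<close>:
  take \<open>t\<close> with \<open>I : (t r)\<close> maximal.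
\<close>

lemma (in cring) common_denominator:
  assumes noeth: "noetherian_ring R" and S: "submonoid S R" and I: "ideal I R"
    and J: "J \<subseteq> carrier R" and r: "r \<in> carrier R"
    and local: "\<And>b. b \<in> J \<Longrightarrow> \<exists>t\<in>S. t \<otimes> (r \<otimes> b) \<in> I"
  shows "\<exists>t\<in>S. t \<otimes> r \<in> ideal_quotient R I J"
proof -
  note Sc = mult_set_simps[OF is_cring S]
  let ?F = "{ideal_quotient R I {t \<otimes> r} | t. t \<in> S}"
  have "?F \<noteq> {}" using Sc(2) by auto
  moreover have "ideal K R" if "K \<in> ?F" for K
    using that ideal_ideal_quotient[OF I] Sc(1) r by auto
  ultimately have "\<exists>M\<in>?F. \<forall>K\<in>?F. M \<subseteq> K \<longrightarrow> K = M"
    by (rule noetherian_ring.ideal_family_maximal[OF noeth])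
  then obtain t where t: "t \<in> S"
    and max: "\<And>u. u \<in> S \<Longrightarrow> ideal_quotient R I {t \<otimes> r} \<subseteq> ideal_quotient R I {u \<otimes> r} \<Longrightarrow>
      ideal_quotient R I {u \<otimes> r} = ideal_quotient R I {t \<otimes> r}" by blast
  have "(t \<otimes> r) \<otimes> b \<in> I" if b: "b \<in> J" for b
  proof -
    have bc: "b \<in> carrier R" using b J by blast
    obtain u where u: "u \<in> S" "u \<otimes> (r \<otimes> b) \<in> I" using local[OF b] by blast
    note c = Sc(1)[OF t] Sc(1)[OF u(1)] r bc
    have "ideal_quotient R I {t \<otimes> r} \<subseteq> ideal_quotient R I {(u \<otimes> t) \<otimes> r}"
    proof
      fix k assume "k \<in> ideal_quotient R I {t \<otimes> r}"
      then have k: "k \<in> carrier R" "k \<otimes> (t \<otimes> r) \<in> I" by (auto simp: ideal_quotient_def)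
      have "k \<otimes> ((u \<otimes> t) \<otimes> r) = u \<otimes> (k \<otimes> (t \<otimes> r))" using k(1) c by algebra
      then show "k \<in> ideal_quotient R I {(u \<otimes> t) \<otimes> r}"
        using ideal_simps(4)[OF I k(2) c(2)] k(1) by (simp add: ideal_quotient_def)
    qed
    then have eq: "ideal_quotient R I {(u \<otimes> t) \<otimes> r} = ideal_quotient R I {t \<otimes> r}"
      by (rule max[OF Sc(3)[OF u(1) t]])
    have "b \<otimes> ((u \<otimes> t) \<otimes> r) = t \<otimes> (u \<otimes> (r \<otimes> b))" using c by algebra
    then have "b \<in> ideal_quotient R I {(u \<otimes> t) \<otimes> r}"
      using ideal_simps(4)[OF I u(2) c(1)] bc by (simp add: ideal_quotient_def)
    then have "b \<otimes> (t \<otimes> r) \<in> I" unfolding eq by (simp add: ideal_quotient_def)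
    then show ?thesis using m_comm[OF bc, of "t \<otimes> r"] c by simp
  qed
  then show ?thesis using t Sc(1)[OF t] r by (auto simp: ideal_quotient_def)
qed

lemma submonoid_compl_prime:
  assumes "primeideal P R"
  shows "submonoid (carrier R - P) R"
proof -
  interpret primeideal P R by (rule assms)
  have "\<one>\<^bsub>R\<^esub> \<notin> P" using I_notcarr one_imp_carrier by blast
  then show ?thesis using I_prime by (intro submonoid.intro) auto
qed

section \<open>Primes over a regular element in dimension one\<close>

lemma (in cring) prime_avoiding:
  assumes noeth: "noetherian_ring R" and T: "submonoid T R" and "\<zero> \<notin> T"
  obtains Q where "primeideal Q R" "Q \<inter> T = {}"
proof -
  note Tc = mult_set_simps[OF is_cring T]
  let ?F = "{I. ideal I R \<and> I \<inter> T = {}}"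
  have "{\<zero>} \<in> ?F" using zeroideal assms(3) by simp
  then have "?F \<noteq> {}" by blast
  moreover have "ideal I R" if "I \<in> ?F" for I using that by blast
  ultimately have "\<exists>M\<in>?F. \<forall>I\<in>?F. M \<subseteq> I \<longrightarrow> I = M"
    by (rule noetherian_ring.ideal_family_maximal[OF noeth])
  then obtain Q where "Q \<in> ?F" and *: "\<forall>I\<in>?F. Q \<subseteq> I \<longrightarrow> I = Q" by (elim bexE)
  then have Q: "ideal Q R" "Q \<inter> T = {}" by simp_all
  have max: "I = Q" if "ideal I R" "I \<inter> T = {}" "Q \<subseteq> I" for I
    using * that by simp
  note Qs = ideal_simps[OF Q(1)]
  have meet: "\<exists>q\<in>Q. \<exists>r\<in>carrier R. q \<oplus> r \<otimes> u \<in> T" if u: "u \<in> carrier R" "u \<notin> Q" for u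
  proof -
    note A = ideal_adjoin[OF Q(1) u(1)]
    have "(Q <+>\<^bsub>R\<^esub> PIdl u) \<inter> T \<noteq> {}" using max[OF A(1) _ A(3)] A(4) u(2) by metis
    then obtain c where "c \<in> Q <+>\<^bsub>R\<^esub> PIdl u" "c \<in> T" by blast
    then show ?thesis unfolding A(2) by blast
  qed
  have "primeideal Q R"
  proof (rule primeidealI[OF Q(1) is_cring])
    show "carrier R \<noteq> Q" using Q(2) Tc(2) one_closed by blast
    fix u v assume u: "u \<in> carrier R" and v: "v \<in> carrier R" and uv: "u \<otimes> v \<in> Q"
    show "u \<in> Q \<or> v \<in> Q"
    proof (rule ccontr)
      assume "\<not> (u \<in> Q \<or> v \<in> Q)"
      then have "u \<notin> Q" "v \<notin> Q" by simp_all
      obtain q r where q: "q \<in> Q" "r \<in> carrier R" "q \<oplus> r \<otimes> u \<in> T"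
        using meet[OF u \<open>u \<notin> Q\<close>] by blast
      obtain q' r' where q': "q' \<in> Q" "r' \<in> carrier R" "q' \<oplus> r' \<otimes> v \<in> T"
        using meet[OF v \<open>v \<notin> Q\<close>] by blast
      have "(q \<oplus> r \<otimes> u) \<otimes> (q' \<oplus> r' \<otimes> v) = (q' \<oplus> r' \<otimes> v) \<otimes> q \<oplus> ((r \<otimes> u) \<otimes> q' \<oplus> (r \<otimes> r') \<otimes> (u \<otimes> v))"
        using Qs(1)[OF q(1)] Qs(1)[OF q'(1)] q(2) q'(2) u v by algebra
      also have "\<dots> \<in> Q"
        using Qs(1)[OF q'(1)] q(2) q'(2) u v by (intro Qs(3,4) q(1) q'(1) uv) auto
      finally show False using Tc(3)[OF q(3) q'(3)] Q(2) by blast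
    qed
  qed
  then show thesis using that Q(2) by blast
qed

text \<open>
  A prime \<open>P\<close> containing a nonzerodivisor is not minimal: the products of a nonzerodivisor with an
  element outside \<open>P\<close> form a multiplicative set without \<open>0\<close>, and a prime avoiding it is strictly
  smaller than \<open>P\<close>.
\<close>

lemma (in cring) smaller_prime:
  assumes noeth: "noetherian_ring R" and P: "primeideal P R"
    and x: "x \<in> non_zerodivisors R" "x \<in> P"
  obtains Q where "primeideal Q R" "Q \<subset> P"
proof -
  note Wc = mult_set_simps[OF is_cring non_zerodivisors_submonoid[OF is_cring]]
  note Sc = mult_set_simps[OF is_cring submonoid_compl_prime[OF P]]
  let ?T = "{w \<otimes> s | w s. w \<in> non_zerodivisors R \<and> s \<in> carrier R - P}"
  have T: "submonoid ?T R"
  proof (rule submonoid.intro)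
    show "?T \<subseteq> carrier R" using Wc(1) by auto
    have "\<one> = \<one> \<otimes> \<one>" by simp
    then show "\<one> \<in> ?T" using Wc(2) Sc(2) by blast
    fix u v assume "u \<in> ?T" "v \<in> ?T"
    then obtain w s w' s' where u: "w \<in> non_zerodivisors R" "s \<in> carrier R - P" "u = w \<otimes> s"
      and v: "w' \<in> non_zerodivisors R" "s' \<in> carrier R - P" "v = w' \<otimes> s'" by blast
    have "u \<otimes> v = (w \<otimes> w') \<otimes> (s \<otimes> s')"
      unfolding u(3) v(3) using Wc(1)[OF u(1)] Wc(1)[OF v(1)] Sc(1)[OF u(2)] Sc(1)[OF v(2)] by algebra
    then show "u \<otimes> v \<in> ?T" using Wc(3)[OF u(1) v(1)] Sc(3)[OF u(2) v(2)] by blast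
  qed
  have zP: "\<zero> \<in> P" using ideal_simps(2)[OF primeideal.axioms(1)[OF P]] .
  have "\<zero> \<notin> ?T"
  proof
    assume "\<zero> \<in> ?T"
    then obtain w s where w: "w \<in> non_zerodivisors R" "s \<in> carrier R" "s \<notin> P" "w \<otimes> s = \<zero>" by auto
    then have "s = \<zero>" by (simp add: non_zerodivisors_def)
    then show False using w(3) zP by simp
  qed
  then obtain Q where Q: "primeideal Q R" "Q \<inter> ?T = {}" by (rule prime_avoiding[OF noeth T])
  note Qs = ideal_simps[OF primeideal.axioms(1)[OF Q(1)]]
  have "s \<in> ?T" if "s \<in> carrier R - P" for s
  proof -
    have "s = \<one> \<otimes> s" using that by simp
    then show ?thesis using Wc(2) that by blast
  qed
  then have "Q \<subseteq> P" using Q(2) Qs(1) by blast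
  moreover have "x = x \<otimes> \<one>" using Wc(1)[OF x(1)] by simp
  then have "x \<in> ?T" using x(1) Sc(2) by blast
  then have "x \<notin> Q" using Q(2) by blast
  ultimately have "Q \<subset> P" using x(2) by blast
  with Q(1) show thesis by (rule that)
qed

lemma (in cring) prime_over_regular_maximal:
  assumes noeth: "noetherian_ring R" and dim: "krull_dimension R \<le> 1"
    and P: "primeideal P R" and x: "x \<in> non_zerodivisors R" "x \<in> P"
    and M: "primeideal M R" "P \<subseteq> M"
  shows "P = M"
proof (rule ccontr)
  assume "P \<noteq> M"
  then have PM: "P \<subset> M" using M(2) by blast
  obtain Q where Q: "primeideal Q R" "Q \<subset> P" using smaller_prime[OF noeth P x] .
  define C where "C i = (if i = 0 then Q else if i = 1 then P else M)" for i :: nat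
  have "\<forall>i\<le>2. primeideal (C i) R" "\<forall>i<2. C i \<subset> C (Suc i)"
    using P M(1) Q PM by (auto simp: C_def less_2_cases_iff)
  then have "enat 2 \<le> krull_dimension R" unfolding krull_dimension_def by (intro Sup_upper) blast
  then have "enat 2 \<le> 1" using dim by (rule order_trans)
  then show False by (simp add: one_enat_def)
qed

lemma (in cring) exists_maximalideal:
  assumes noeth: "noetherian_ring R" and K: "ideal K R" "K \<noteq> carrier R"
  obtains M where "maximalideal M R" "K \<subseteq> M"
proof -
  let ?F = "{I. ideal I R \<and> K \<subseteq> I \<and> I \<noteq> carrier R}"
  have "K \<in> ?F" using K by simp
  then have "?F \<noteq> {}" by blast
  moreover have "ideal I R" if "I \<in> ?F" for I using that by simp
  ultimately have "\<exists>M\<in>?F. \<forall>I\<in>?F. M \<subseteq> I \<longrightarrow> I = M"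
    by (rule noetherian_ring.ideal_family_maximal[OF noeth])
  then obtain M where "M \<in> ?F" and max: "\<forall>I\<in>?F. M \<subseteq> I \<longrightarrow> I = M" by (elim bexE)
  then have M: "ideal M R" "K \<subseteq> M" "M \<noteq> carrier R" by simp_all
  have "maximalideal M R"
  proof (rule maximalidealI[OF M(1)])
    show "carrier R \<noteq> M" using M(3) by simp
    show "I = M \<or> I = carrier R" if "ideal I R" "M \<subseteq> I" for I
      using max that M(2) by auto
  qed
  then show thesis using M(2) by (rule that)
qed

section \<open>Double ideal quotients in Gorenstein rings of dimension one\<close>

text \<open>
  An ideal equality may be tested at the maximal ideals.  If \<open>a \<notin> J\<close>, then \<open>J : a\<close> lies in a maximal
  ideal \<open>\<mm>\<close>, and \<open>a / 1\<close> stays outside \<open>J R\<^sub>\<mm>\<close>.  In \<open>R\<^sub>\<mm>\<close> only one prime contains \<open>x\<close>, as a prime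
  containing a nonzerodivisor is maximal in dimension one.
\<close>

theorem double_ideal_quotient_gorenstein:
  fixes R :: "('a, 'x) ring_scheme" (structure)
  assumes gor: "gorenstein_ring TYPE('e) R" and dim: "krull_dimension R \<le> 1"
    and x: "x \<in> non_zerodivisors R" and J: "ideal J R" and xJ: "x \<in> J"
  shows "ideal_quotient R (PIdl x) (ideal_quotient R (PIdl x) J) = J"
proof
  have R: "cring R" and noeth: "noetherian_ring R" using gor by (auto simp: gorenstein_ring_def)
  interpret cring R by (rule R)
  have xc: "x \<in> carrier R" using x by (simp add: non_zerodivisors_def)
  note X = cgenideal_ideal[OF xc]
  note Js = ideal_simps[OF J]
  show "J \<subseteq> ideal_quotient R (PIdl x) (ideal_quotient R (PIdl x) J)"
  proof
    fix b assume b: "b \<in> J"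
    have "b \<otimes> r \<in> PIdl x" if "r \<in> ideal_quotient R (PIdl x) J" for r
      using that b m_comm[OF Js(1)[OF b], of r] by (simp add: ideal_quotient_def)
    then show "b \<in> ideal_quotient R (PIdl x) (ideal_quotient R (PIdl x) J)"
      using Js(1)[OF b] by (simp add: ideal_quotient_def[of R _ "ideal_quotient R (PIdl x) J"])
  qed
  show "ideal_quotient R (PIdl x) (ideal_quotient R (PIdl x) J) \<subseteq> J"
  proof (rule subsetI, rule ccontr)
    fix a assume aq: "a \<in> ideal_quotient R (PIdl x) (ideal_quotient R (PIdl x) J)" and aJ: "a \<notin> J"
    then have a: "a \<in> carrier R" by (simp add: ideal_quotient_def)
    define K where "K = ideal_quotient R J {a}"
    have K: "ideal K R" unfolding K_def using ideal_ideal_quotient[OF J] a by simp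
    have "K \<noteq> carrier R" unfolding K_def by (rule proper_ideal_quotient[OF a aJ])
    obtain M where M: "maximalideal M R" "K \<subseteq> M"
      by (rule exists_maximalideal[OF noeth K \<open>K \<noteq> carrier R\<close>])
    have P: "primeideal M R" using maximalideal_prime[OF M(1)] .
    define S where "S = carrier R - M"
    have S: "submonoid S R" unfolding S_def by (rule submonoid_compl_prime[OF P])
    note Sc = mult_set_simps[OF R S]
    define L where "L = localization R S"
    have "finite_injective_dimension TYPE('e) L (ring_module L)"
      using gor M(1) unfolding gorenstein_ring_def Let_def L_def S_def by blast
    then obtain n and E :: "nat \<Rightarrow> (('a \<times> 'a) set, 'e) module" and \<epsilon> d where
      res: "injective_resolution L (ring_module L) E \<epsilon> d" "\<And>i. n < i \<Longrightarrow> carrier (E i) = {\<zero>\<^bsub>E i\<^esub>}"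
      unfolding finite_injective_dimension_def by blast
    interpret L: cring L unfolding L_def by (rule localization_cring[OF R S])
    interpret ring_resolution L E \<epsilon> d by unfold_locales (rule res(1))
    let ?x = "fraction R S x \<one>" and ?J = "extended_ideal R S J"
    have "ideal_quotient L (PIdl\<^bsub>L\<^esub> ?x) (ideal_quotient L (PIdl\<^bsub>L\<^esub> ?x) ?J) \<subseteq> ?J"
    proof (rule double_ideal_quotient_principal)
      show "noetherian_ring L" unfolding L_def by (rule noetherian_localization[OF R S noeth])
      show "?x \<in> non_zerodivisors L" unfolding L_def by (rule fraction_non_zerodivisor[OF R S x])
      show "carrier (E i) = {\<zero>\<^bsub>E i\<^esub>}" if "n < i" for i using res(2)[OF that] .
      show "ideal ?J L" unfolding L_def by (rule ideal_extended_ideal[OF R S J])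
      show "?x \<in> ?J" unfolding extended_ideal_def using xJ Sc(2) by blast
      fix P P' assume "primeideal P L" "primeideal P' L" "?x \<in> P" "?x \<in> P'"
      moreover have "contracted_ideal R S N = M" if "primeideal N L" "?x \<in> N" for N
      proof (rule prime_over_regular_maximal[OF noeth dim _ x _ P])
        note N = primeideal_contracted_ideal[OF R S that(1)[unfolded L_def]]
        show "primeideal (contracted_ideal R S N) R" by (rule N(1))
        show "x \<in> contracted_ideal R S N" using that(2) xc by (simp add: contracted_ideal_def)
        show "contracted_ideal R S N \<subseteq> M" using N(2) unfolding S_def contracted_ideal_def by blast
      qed
      ultimately have "contracted_ideal R S P = contracted_ideal R S P'"
        "ideal P (localization R S)" "ideal P' (localization R S)"
        using primeideal.axioms(1) unfolding L_def by blast+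
      then show "P = P'" using contracted_ideal_subset_imp_subset[OF R S] by (intro equalityI) auto
    qed
    moreover have "fraction R S a \<one> \<in> ideal_quotient L (PIdl\<^bsub>L\<^esub> ?x) (ideal_quotient L (PIdl\<^bsub>L\<^esub> ?x) ?J)"
      unfolding ideal_quotient_def[of L _ "ideal_quotient L (PIdl\<^bsub>L\<^esub> ?x) ?J"]
    proof (intro CollectI conjI ballI)
      show "fraction R S a \<one> \<in> carrier L" unfolding L_def using fraction_closed[OF R S a Sc(2)] .
      fix q assume "q \<in> ideal_quotient L (PIdl\<^bsub>L\<^esub> ?x) ?J"
      then have q: "q \<in> carrier (localization R S)" and
        qJ: "\<And>p. p \<in> ?J \<Longrightarrow> q \<otimes>\<^bsub>localization R S\<^esub> p \<in> extended_ideal R S (PIdl x)"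
        unfolding ideal_quotient_def L_def extended_PIdl[OF R S xc] by auto
      obtain r s where r: "r \<in> carrier R" "s \<in> S" "q = fraction R S r s"
        by (rule localization_carrierE[OF R S q])
      have "\<exists>t\<in>S. t \<otimes> (r \<otimes> b) \<in> PIdl x" if b: "b \<in> J" for b
      proof -
        have "fraction R S b \<one> \<in> ?J" unfolding extended_ideal_def using b Sc(2) by blast
        from qJ[OF this] have "fraction R S (r \<otimes> b) (s \<otimes> \<one>) \<in> extended_ideal R S (PIdl x)"
          unfolding r(3) using localization_mult[OF R S r(1) Js(1)[OF b] r(2) Sc(2)] by simp
        then show ?thesis
          using fraction_mem_extended_ideal_iff[OF R S X, of "r \<otimes> b" "s \<otimes> \<one>"] r(1) Js(1)[OF b]
            Sc(3)[OF r(2) Sc(2)] by simp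
      qed
      moreover have "J \<subseteq> carrier R" using Js(1) by blast
      ultimately obtain t where t: "t \<in> S" "t \<otimes> r \<in> ideal_quotient R (PIdl x) J"
        using common_denominator[OF noeth S X _ r(1)] by blast
      have "a \<otimes> (t \<otimes> r) \<in> PIdl x" using aq t(2) by (simp add: ideal_quotient_def)
      then have "t \<otimes> (a \<otimes> r) \<in> PIdl x" using a r(1) Sc(1)[OF t(1)] by (simp add: m_lcomm)
      then have "fraction R S (a \<otimes> r) (\<one> \<otimes> s) \<in> extended_ideal R S (PIdl x)"
        using fraction_mem_extended_ideal_iff[OF R S X, of "a \<otimes> r" "\<one> \<otimes> s"] a r(1) t(1)
          Sc(3)[OF Sc(2) r(2)] by blast
      then show "fraction R S a \<one> \<otimes>\<^bsub>L\<^esub> q \<in> PIdl\<^bsub>L\<^esub> ?x"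
        unfolding r(3) L_def localization_mult[OF R S a r(1) Sc(2) r(2)] extended_PIdl[OF R S xc] .
    qed
    ultimately have "fraction R S a \<one> \<in> ?J" by blast
    then obtain t where "t \<in> S" "t \<otimes> a \<in> J"
      using fraction_mem_extended_ideal_iff[OF R S J a Sc(2)] by blast
    then have "t \<in> K" "t \<notin> M" unfolding K_def S_def ideal_quotient_def by auto
    then show False using M(2) by blast
  qed
qed

section \<open>Regular trace ideals and birational extensions\<close>

lemma ideal_trace_ideal:
  assumes "cring R" "trace_ideal I R"
  shows "ideal I R"
proof -
  interpret cring R by (rule assms(1))
  obtain M :: "('a, 'a) module" where M: "I = trace_of_module R M" using assms(2) unfolding trace_ideal_def by blast
  have "{f m | f m. f \<in> module_homs R M (ring_module R) \<and> m \<in> carrier M} \<subseteq> carrier R"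
    by (auto simp: module_homs_def ring_module_def)
  then show ?thesis unfolding M trace_of_module_def by (rule genideal_ideal)
qed

context
  fixes R :: "('a, 'x) ring_scheme" (structure)
  assumes R: "cring R"
begin

interpretation cring R by (rule R)

private abbreviation "Q \<equiv> total_fractions R"
private abbreviation "W \<equiv> non_zerodivisors R"
private abbreviation "\<phi> \<equiv> embed_fractions R"

private lemmas W = non_zerodivisors_submonoid[OF R]
private lemmas Wc = mult_set_simps[OF R W]

interpretation Q: cring Q
  unfolding total_fractions_def by (rule localization_cring[OF R W])

lemma embed_closed: "r \<in> carrier R \<Longrightarrow> \<phi> r \<in> carrier Q"
  unfolding total_fractions_def embed_fractions_def using fraction_closed[OF R W] Wc(2) by blast

lemma embed_mult: "r \<in> carrier R \<Longrightarrow> s \<in> carrier R \<Longrightarrow> \<phi> (r \<otimes> s) = \<phi> r \<otimes>\<^bsub>Q\<^esub> \<phi> s"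
  unfolding total_fractions_def embed_fractions_def
  using localization_mult[OF R W _ _ Wc(2) Wc(2), of r s] by simp

lemma embed_add: "r \<in> carrier R \<Longrightarrow> s \<in> carrier R \<Longrightarrow> \<phi> (r \<oplus> s) = \<phi> r \<oplus>\<^bsub>Q\<^esub> \<phi> s"
  unfolding total_fractions_def embed_fractions_def
  using localization_add[OF R W _ _ Wc(2) Wc(2), of r s] by simp

lemma embed_zero: "\<phi> \<zero> = \<zero>\<^bsub>Q\<^esub>"
  unfolding total_fractions_def embed_fractions_def localization_zero[OF R W] ..

lemma embed_eq: "r \<in> carrier R \<Longrightarrow> s \<in> carrier R \<Longrightarrow> \<phi> r = \<phi> s \<Longrightarrow> r = s"
  using inj_on_embed_fractions[OF R] by (rule inj_onD)

lemma embed_cancel: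
  assumes a: "a \<in> W" and "y \<in> carrier Q" "z \<in> carrier Q" "\<phi> a \<otimes>\<^bsub>Q\<^esub> y = \<phi> a \<otimes>\<^bsub>Q\<^esub> z"
  shows "y = z"
proof -
  let ?u = "fraction R W \<one> a"
  note ac = Wc(1)[OF a]
  have u: "?u \<in> carrier Q"
    unfolding total_fractions_def using fraction_closed[OF R W one_closed a] .
  have "?u \<otimes>\<^bsub>Q\<^esub> \<phi> a = fraction R W (\<one> \<otimes> a) (a \<otimes> \<one>)"
    unfolding total_fractions_def embed_fractions_def
    using localization_mult[OF R W one_closed ac a Wc(2)] .
  also have "\<dots> = \<one>\<^bsub>Q\<^esub>"
    unfolding total_fractions_def localization_one[OF R W]
    by (rule fraction_eqI[OF R W]) (use a ac Wc in auto)
  finally have ua: "?u \<otimes>\<^bsub>Q\<^esub> \<phi> a = \<one>\<^bsub>Q\<^esub>" .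
  have "?u \<otimes>\<^bsub>Q\<^esub> \<phi> a \<otimes>\<^bsub>Q\<^esub> y = ?u \<otimes>\<^bsub>Q\<^esub> \<phi> a \<otimes>\<^bsub>Q\<^esub> z"
    using assms(2-4) u embed_closed[OF ac] by (simp only: Q.m_assoc)
  then show ?thesis using assms(2,3) unfolding ua by simp
qed

lemma embed_divide:
  assumes a: "a \<in> W" and r: "r \<in> carrier R"
  obtains q where "q \<in> carrier Q" "\<phi> a \<otimes>\<^bsub>Q\<^esub> q = \<phi> r"
proof
  note ac = Wc(1)[OF a]
  show "fraction R W r a \<in> carrier Q"
    unfolding total_fractions_def using fraction_closed[OF R W r a] .
  have "\<phi> a \<otimes>\<^bsub>Q\<^esub> fraction R W r a = fraction R W (a \<otimes> r) (\<one> \<otimes> a)"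
    unfolding total_fractions_def embed_fractions_def using localization_mult[OF R W ac r Wc(2) a] .
  also have "\<dots> = \<phi> r"
    unfolding embed_fractions_def by (rule fraction_eqI[OF R W]) (use a ac r Wc in auto)
  finally show "\<phi> a \<otimes>\<^bsub>Q\<^esub> fraction R W r a = \<phi> r" .
qed

text \<open>
  Multiplication by \<open>q \<in> R : I\<close> is a homomorphism \<open>I \<rightarrow> R\<close>; composed with the homomorphisms \<open>M \<rightarrow> R\<close> whose
  values generate \<open>I\<close>, it gives further homomorphisms \<open>M \<rightarrow> R\<close>.  So \<open>R : I = I : I\<close> for a trace ideal.
\<close>

lemma trace_ideal_multiplier:
  assumes I: "trace_ideal I R" and q: "q \<in> carrier Q"
    and qI: "\<And>b. b \<in> I \<Longrightarrow> q \<otimes>\<^bsub>Q\<^esub> \<phi> b \<in> \<phi> ` carrier R" and b: "b \<in> I"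
  shows "q \<otimes>\<^bsub>Q\<^esub> \<phi> b \<in> \<phi> ` I"
proof -
  have ideal: "ideal I R" by (rule ideal_trace_ideal[OF R I])
  note Is = ideal_simps[OF ideal]
  obtain M :: "('a, 'a) module" where M: "module R M" "I = trace_of_module R M"
    using I unfolding trace_ideal_def by blast
  interpret M: module R M by (rule M(1))
  let ?G = "{f m | f m. f \<in> module_homs R M (ring_module R) \<and> m \<in> carrier M}"
  have "?G \<subseteq> carrier R" by (auto simp: module_homs_def ring_module_def)
  then have GI: "?G \<subseteq> I" unfolding M(2) trace_of_module_def by (rule genideal_self)
  let ?J = "{b \<in> I. q \<otimes>\<^bsub>Q\<^esub> \<phi> b \<in> \<phi> ` I}"
  have J: "ideal ?J R"
  proof (rule ideal_of_closed)
    show "?J \<subseteq> carrier R" using Is(1) by blast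
    have "q \<otimes>\<^bsub>Q\<^esub> \<phi> \<zero> = \<phi> \<zero>" using q by (simp add: embed_zero)
    then show "\<zero> \<in> ?J" using Is(2) by auto
    fix a b assume "a \<in> ?J" "b \<in> ?J"
    then obtain a' b' where a: "a \<in> I" "a' \<in> I" "q \<otimes>\<^bsub>Q\<^esub> \<phi> a = \<phi> a'"
      and b: "b \<in> I" "b' \<in> I" "q \<otimes>\<^bsub>Q\<^esub> \<phi> b = \<phi> b'" by blast
    have "q \<otimes>\<^bsub>Q\<^esub> \<phi> (a \<oplus> b) = \<phi> (a' \<oplus> b')"
      using a b q Is(1) by (simp add: embed_add embed_closed Q.r_distr)
    then show "a \<oplus> b \<in> ?J" using Is(3)[OF a(1) b(1)] Is(3)[OF a(2) b(2)] by auto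
  next
    fix a r assume "a \<in> ?J" and r: "r \<in> carrier R"
    then obtain a' where a: "a \<in> I" "a' \<in> I" "q \<otimes>\<^bsub>Q\<^esub> \<phi> a = \<phi> a'" by blast
    have "q \<otimes>\<^bsub>Q\<^esub> \<phi> (r \<otimes> a) = \<phi> r \<otimes>\<^bsub>Q\<^esub> (q \<otimes>\<^bsub>Q\<^esub> \<phi> a)"
      unfolding embed_mult[OF r Is(1)[OF a(1)]]
      by (rule Q.m_lcomm[OF q embed_closed[OF r] embed_closed[OF Is(1)[OF a(1)]]])
    also have "\<dots> = \<phi> (r \<otimes> a')" unfolding a(3) using embed_mult[OF r Is(1)[OF a(2)]] by simp
    finally have "q \<otimes>\<^bsub>Q\<^esub> \<phi> (r \<otimes> a) = \<phi> (r \<otimes> a')" .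
    then show "r \<otimes> a \<in> ?J" using Is(4)[OF a(1) r] Is(4)[OF a(2) r] by auto
  qed
  have "?G \<subseteq> ?J"
  proof
    fix b assume bG: "b \<in> ?G"
    then obtain f m where f: "f \<in> module_homs R M (ring_module R)" "m \<in> carrier M" "b = f m" by blast
    have fI: "f y \<in> I" if "y \<in> carrier M" for y using GI f(1) that by blast
    have f_add: "f (y \<oplus>\<^bsub>M\<^esub> z) = f y \<oplus> f z" if "y \<in> carrier M" "z \<in> carrier M" for y z
      using module_homsD(2)[OF f(1) that] by (simp add: ring_module_def)
    have f_mult: "f (r \<odot>\<^bsub>M\<^esub> y) = r \<otimes> f y" if "r \<in> carrier R" "y \<in> carrier M" for r y
      using module_homsD(3)[OF f(1) that] by (simp add: ring_module_def)
    define g where "g y = inv_into (carrier R) \<phi> (q \<otimes>\<^bsub>Q\<^esub> \<phi> (f y))" for y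
    have g: "g y \<in> carrier R" "\<phi> (g y) = q \<otimes>\<^bsub>Q\<^esub> \<phi> (f y)" if "y \<in> carrier M" for y
      unfolding g_def using inv_into_into f_inv_into_f qI[OF fI[OF that]] by metis+
    have "g (y \<oplus>\<^bsub>M\<^esub> z) = g y \<oplus> g z" if y: "y \<in> carrier M" and z: "z \<in> carrier M" for y z
    proof (rule embed_eq)
      show "\<phi> (g (y \<oplus>\<^bsub>M\<^esub> z)) = \<phi> (g y \<oplus> g z)"
        using g[OF y] g[OF z] g[OF M.M.a_closed[OF y z]] f_add[OF y z] Is(1)[OF fI[OF y]] Is(1)[OF fI[OF z]] q
        by (simp add: embed_add embed_closed Q.r_distr)
    qed (use g y z in auto)
    moreover have "g (r \<odot>\<^bsub>M\<^esub> y) = r \<otimes> g y" if r: "r \<in> carrier R" and y: "y \<in> carrier M" for r y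
    proof (rule embed_eq)
      show "\<phi> (g (r \<odot>\<^bsub>M\<^esub> y)) = \<phi> (r \<otimes> g y)"
        using g[OF y] g[OF M.smult_closed[OF r y]] f_mult[OF r y] Is(1)[OF fI[OF y]] r q
        by (simp add: embed_mult embed_closed Q.m_lcomm)
    qed (use g r y in auto)
    ultimately have "g \<in> module_homs R M (ring_module R)"
      using g(1) by (simp add: module_homs_def ring_module_def)
    then have "g m \<in> I" using GI f(2) by blast
    moreover have "q \<otimes>\<^bsub>Q\<^esub> \<phi> b = \<phi> (g m)" using g(2)[OF f(2)] f(3) by simp
    ultimately show "b \<in> ?J" using bG GI by blast
  qed
  then have "I \<subseteq> ?J" unfolding M(2) trace_of_module_def
    using genideal_minimal J unfolding M(2) trace_of_module_def by blast
  then show ?thesis using b by blast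
qed

text \<open>
  Conversely, a homomorphism from an ideal \<open>c\<close> containing a nonzerodivisor \<open>x\<close> to \<open>R\<close> is multiplication by
  its value at \<open>x\<close> divided by \<open>x\<close>, an element of \<open>R : c\<close>.
\<close>

lemma trace_ideal_of_multipliers:
  assumes c: "ideal c R" and x: "x \<in> c" "x \<in> W"
    and mult: "\<And>q b. q \<in> carrier Q \<Longrightarrow> (\<And>b. b \<in> c \<Longrightarrow> q \<otimes>\<^bsub>Q\<^esub> \<phi> b \<in> \<phi> ` carrier R) \<Longrightarrow>
      b \<in> c \<Longrightarrow> q \<otimes>\<^bsub>Q\<^esub> \<phi> b \<in> \<phi> ` c"
  shows "trace_ideal c R"
proof -
  note cs = ideal_simps[OF c]
  note xc = Wc(1)[OF x(2)]
  let ?M = "singleton_module R c"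
  let ?G = "{f m | f m. f \<in> module_homs R ?M (ring_module R) \<and> m \<in> carrier ?M}"
  have GR: "?G \<subseteq> carrier R" by (auto simp: module_homs_def ring_module_def)
  have "?G \<subseteq> c"
  proof
    fix r assume "r \<in> ?G"
    then obtain f b where f: "f \<in> module_homs R ?M (ring_module R)" and b: "b \<in> c" "r = f {b}"
      by (auto simp: singleton_module_def)
    have fc: "f {b} \<in> carrier R" if "b \<in> c" for b
      using module_homsD(1)[OF f, of "{b}"] that by (simp add: ring_module_def singleton_module_def)
    have f_mult: "f {s \<otimes> b} = s \<otimes> f {b}" if "b \<in> c" "s \<in> carrier R" for b s
      using module_homsD(3)[OF f that(2), of "{b}"] that(1)
      by (simp add: ring_module_def singleton_module_def)
    obtain q where q: "q \<in> carrier Q" "\<phi> x \<otimes>\<^bsub>Q\<^esub> q = \<phi> (f {x})"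
      using embed_divide[OF x(2) fc[OF x(1)]] .
    have qf: "q \<otimes>\<^bsub>Q\<^esub> \<phi> b = \<phi> (f {b})" if b: "b \<in> c" for b
    proof (rule embed_cancel[OF x(2)])
      note bc = cs(1)[OF b]
      have "\<phi> x \<otimes>\<^bsub>Q\<^esub> (q \<otimes>\<^bsub>Q\<^esub> \<phi> b) = \<phi> b \<otimes>\<^bsub>Q\<^esub> (\<phi> x \<otimes>\<^bsub>Q\<^esub> q)"
        using q(1) embed_closed[OF bc] embed_closed[OF xc] by (simp add: Q.m_ac)
      also have "\<dots> = \<phi> (b \<otimes> f {x})" unfolding q(2) using embed_mult[OF bc fc[OF x(1)]] by simp
      also have "b \<otimes> f {x} = x \<otimes> f {b}"
        using f_mult[OF x(1) bc] f_mult[OF b xc] m_comm[OF bc xc] by simp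
      also have "\<phi> (x \<otimes> f {b}) = \<phi> x \<otimes>\<^bsub>Q\<^esub> \<phi> (f {b})" by (rule embed_mult[OF xc fc[OF b]])
      finally show "\<phi> x \<otimes>\<^bsub>Q\<^esub> (q \<otimes>\<^bsub>Q\<^esub> \<phi> b) = \<phi> x \<otimes>\<^bsub>Q\<^esub> \<phi> (f {b})" .
    qed (use q(1) embed_closed cs(1)[OF b] fc[OF b] in auto)
    have "q \<otimes>\<^bsub>Q\<^esub> \<phi> b \<in> \<phi> ` c" by (rule mult[OF q(1) _ b(1)]) (use qf fc in auto)
    then obtain b' where "b' \<in> c" "\<phi> (f {b}) = \<phi> b'" unfolding qf[OF b(1)] by blast
    then show "r \<in> c" using embed_eq[OF fc[OF b(1)] cs(1)] b(2) by auto
  qed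
  then have "Idl ?G \<subseteq> c" by (rule genideal_minimal[OF c])
  moreover have "c \<subseteq> Idl ?G"
  proof
    fix b assume b: "b \<in> c"
    have "the_elem \<in> module_homs R ?M (ring_module R)"
      using cs(1) by (auto simp: module_homs_def singleton_module_def ring_module_def)
    moreover have "{b} \<in> carrier ?M" "the_elem {b} = b" using b by (auto simp: singleton_module_def)
    ultimately have "b \<in> ?G" by (metis (mono_tags, lifting) mem_Collect_eq)
    then show "b \<in> Idl ?G" using genideal_self[OF GR] by blast
  qed
  ultimately have "c = trace_of_module R ?M" unfolding trace_of_module_def by blast
  then show ?thesis using trace_ideal_any_type[OF module_singleton_module[OF c]] by simp
qed

lemma mem_rho_iff: "q \<in> rho R I \<longleftrightarrow> q \<in> carrier Q \<and> (\<forall>b\<in>I. q \<otimes>\<^bsub>Q\<^esub> \<phi> b \<in> \<phi> ` I)"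
  by (auto simp: rho_def colon_def)

lemma mem_eta_iff: "r \<in> eta R A \<longleftrightarrow> r \<in> carrier R \<and> (\<forall>v\<in>A. \<phi> r \<otimes>\<^bsub>Q\<^esub> v \<in> \<phi> ` carrier R)"
  using embed_closed by (auto simp: eta_def colon_def)

lemma rho_birational:
  assumes "I \<in> regular_trace_ideals R"
  shows "rho R I \<in> birational_extensions R"
proof -
  obtain x where x: "x \<in> I" "x \<in> W" and "trace_ideal I R"
    using assms unfolding regular_trace_ideals_def by blast
  then have I: "ideal I R" using ideal_trace_ideal[OF R] by blast
  note Is = ideal_simps[OF I]
  have "subring (rho R I) Q"
  proof (rule Q.subringI)
    show "rho R I \<subseteq> carrier Q" by (auto simp: mem_rho_iff)
    show "\<one>\<^bsub>Q\<^esub> \<in> rho R I" using Is(1) embed_closed by (auto simp: mem_rho_iff)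
    fix p assume p: "p \<in> rho R I"
    then have pc: "p \<in> carrier Q" and pI: "\<And>b. b \<in> I \<Longrightarrow> \<exists>b'\<in>I. p \<otimes>\<^bsub>Q\<^esub> \<phi> b = \<phi> b'"
      by (auto simp: mem_rho_iff)
    have "\<ominus>\<^bsub>Q\<^esub> p \<otimes>\<^bsub>Q\<^esub> \<phi> b \<in> \<phi> ` I" if b: "b \<in> I" for b
    proof -
      have "\<phi> b \<in> carrier Q" "\<phi> (\<ominus> b) \<in> carrier Q" using embed_closed Is(1)[OF b] by auto
      moreover have "\<phi> (\<ominus> b) \<oplus>\<^bsub>Q\<^esub> \<phi> b = \<zero>\<^bsub>Q\<^esub>"
        using embed_add[of "\<ominus> b" b] Is(1)[OF b] by (simp add: l_neg embed_zero)
      ultimately have neg: "\<ominus>\<^bsub>Q\<^esub> \<phi> b = \<phi> (\<ominus> b)" by (intro Q.minus_equality)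
      then have "\<ominus>\<^bsub>Q\<^esub> p \<otimes>\<^bsub>Q\<^esub> \<phi> b = p \<otimes>\<^bsub>Q\<^esub> \<phi> (\<ominus> b)"
        unfolding neg[symmetric] using pc \<open>\<phi> b \<in> carrier Q\<close> by (simp add: Q.l_minus Q.r_minus)
      then show ?thesis using pI[OF Is(7)[OF b]] by auto
    qed
    then show "\<ominus>\<^bsub>Q\<^esub> p \<in> rho R I" using pc by (simp add: mem_rho_iff)
    fix p' assume p': "p' \<in> rho R I"
    then have pc': "p' \<in> carrier Q" and pI': "\<And>b. b \<in> I \<Longrightarrow> \<exists>b'\<in>I. p' \<otimes>\<^bsub>Q\<^esub> \<phi> b = \<phi> b'"
      by (auto simp: mem_rho_iff)
    have "p \<otimes>\<^bsub>Q\<^esub> p' \<otimes>\<^bsub>Q\<^esub> \<phi> b \<in> \<phi> ` I" "(p \<oplus>\<^bsub>Q\<^esub> p') \<otimes>\<^bsub>Q\<^esub> \<phi> b \<in> \<phi> ` I" if b: "b \<in> I" for b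
    proof -
      obtain b' where b': "b' \<in> I" "p' \<otimes>\<^bsub>Q\<^esub> \<phi> b = \<phi> b'" using pI'[OF b] by blast
      obtain b1 where b1: "b1 \<in> I" "p \<otimes>\<^bsub>Q\<^esub> \<phi> b = \<phi> b1" using pI[OF b] by blast
      obtain b2 where b2: "b2 \<in> I" "p \<otimes>\<^bsub>Q\<^esub> \<phi> b' = \<phi> b2" using pI[OF b'(1)] by blast
      have bc: "\<phi> b \<in> carrier Q" using embed_closed[OF Is(1)[OF b]] .
      have "p \<otimes>\<^bsub>Q\<^esub> p' \<otimes>\<^bsub>Q\<^esub> \<phi> b = \<phi> b2" using pc pc' bc b' b2 by (simp add: Q.m_assoc)
      then show "p \<otimes>\<^bsub>Q\<^esub> p' \<otimes>\<^bsub>Q\<^esub> \<phi> b \<in> \<phi> ` I" using b2(1) by blast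
      have "(p \<oplus>\<^bsub>Q\<^esub> p') \<otimes>\<^bsub>Q\<^esub> \<phi> b = \<phi> (b1 \<oplus> b')"
        using pc pc' bc b' b1 Is(1) by (simp add: Q.l_distr embed_add)
      then show "(p \<oplus>\<^bsub>Q\<^esub> p') \<otimes>\<^bsub>Q\<^esub> \<phi> b \<in> \<phi> ` I" using Is(3)[OF b1(1) b'(1)] by blast
    qed
    then show "p \<otimes>\<^bsub>Q\<^esub> p' \<in> rho R I" "p \<oplus>\<^bsub>Q\<^esub> p' \<in> rho R I" using pc pc' by (simp_all add: mem_rho_iff)
  qed
  moreover have "\<phi> ` carrier R \<subseteq> rho R I"
  proof
    fix q assume "q \<in> \<phi> ` carrier R"
    then obtain r where r: "r \<in> carrier R" "q = \<phi> r" by blast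
    have "\<phi> r \<otimes>\<^bsub>Q\<^esub> \<phi> b \<in> \<phi> ` I" if "b \<in> I" for b
      using embed_mult[OF r(1) Is(1)[OF that]] Is(4)[OF that r(1)] by (metis imageI)
    then show "q \<in> rho R I" unfolding r(2) using embed_closed[OF r(1)] by (simp add: mem_rho_iff)
  qed
  moreover have "\<phi> x \<otimes>\<^bsub>Q\<^esub> q \<in> \<phi> ` carrier R" if q: "q \<in> rho R I" for q
  proof -
    have "q \<in> carrier Q" "q \<otimes>\<^bsub>Q\<^esub> \<phi> x \<in> \<phi> ` I" using q x(1) by (auto simp: mem_rho_iff)
    then show ?thesis using Q.m_comm[OF embed_closed[OF Is(1)[OF x(1)]]] Is(1) by auto
  qed
  ultimately show ?thesis unfolding birational_extensions_def using x(2) by blast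
qed

lemma birationalD:
  assumes "A \<in> birational_extensions R"
  shows "\<And>v. v \<in> A \<Longrightarrow> v \<in> carrier Q" "\<one>\<^bsub>Q\<^esub> \<in> A" "\<And>v w. v \<in> A \<Longrightarrow> w \<in> A \<Longrightarrow> v \<otimes>\<^bsub>Q\<^esub> w \<in> A"
    "\<And>v w. v \<in> A \<Longrightarrow> w \<in> A \<Longrightarrow> v \<oplus>\<^bsub>Q\<^esub> w \<in> A" "\<And>r. r \<in> carrier R \<Longrightarrow> \<phi> r \<in> A"
proof -
  have A: "subring A Q" "\<phi> ` carrier R \<subseteq> A" using assms unfolding birational_extensions_def by auto
  show "\<And>v. v \<in> A \<Longrightarrow> v \<in> carrier Q" "\<one>\<^bsub>Q\<^esub> \<in> A" "\<And>v w. v \<in> A \<Longrightarrow> w \<in> A \<Longrightarrow> v \<otimes>\<^bsub>Q\<^esub> w \<in> A"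
    "\<And>v w. v \<in> A \<Longrightarrow> w \<in> A \<Longrightarrow> v \<oplus>\<^bsub>Q\<^esub> w \<in> A" "\<And>r. r \<in> carrier R \<Longrightarrow> \<phi> r \<in> A"
    using subringE[OF A(1)] A(2) by auto
qed

text \<open>The conductor \<open>R : A\<close> is an ideal of \<open>A\<close>.\<close>

lemma eta_absorbs:
  assumes A: "A \<in> birational_extensions R" and r: "r \<in> eta R A" and v: "v \<in> A"
  obtains s where "s \<in> eta R A" "\<phi> r \<otimes>\<^bsub>Q\<^esub> v = \<phi> s"
proof -
  note As = birationalD[OF A]
  have rc: "r \<in> carrier R" and rA: "\<And>v. v \<in> A \<Longrightarrow> \<phi> r \<otimes>\<^bsub>Q\<^esub> v \<in> \<phi> ` carrier R"
    using r by (auto simp: mem_eta_iff)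
  obtain s where s: "s \<in> carrier R" "\<phi> r \<otimes>\<^bsub>Q\<^esub> v = \<phi> s" using rA[OF v] by blast
  have "\<phi> s \<otimes>\<^bsub>Q\<^esub> w \<in> \<phi> ` carrier R" if "w \<in> A" for w
    unfolding s(2)[symmetric] using rA[OF As(3)[OF v that]] As(1)[OF v] As(1)[OF that] embed_closed[OF rc]
    by (simp add: Q.m_assoc)
  then have "s \<in> eta R A" using s(1) by (simp add: mem_eta_iff)
  with s(2) that show thesis by blast
qed

lemma ideal_eta:
  assumes A: "A \<in> birational_extensions R"
  shows "ideal (eta R A) R"
proof (rule ideal_of_closed)
  note As = birationalD[OF A]
  show "eta R A \<subseteq> carrier R" by (auto simp: mem_eta_iff)
  have "\<phi> \<zero> \<otimes>\<^bsub>Q\<^esub> v = \<phi> \<zero>" if "v \<in> A" for v using As(1)[OF that] by (simp add: embed_zero)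
  then show "\<zero> \<in> eta R A" by (simp add: mem_eta_iff)
next
  note As = birationalD[OF A]
  fix a b assume "a \<in> eta R A" "b \<in> eta R A"
  then have c: "a \<in> carrier R" "b \<in> carrier R"
    and a: "\<And>v. v \<in> A \<Longrightarrow> \<exists>s\<in>carrier R. \<phi> a \<otimes>\<^bsub>Q\<^esub> v = \<phi> s"
    and b: "\<And>v. v \<in> A \<Longrightarrow> \<exists>s\<in>carrier R. \<phi> b \<otimes>\<^bsub>Q\<^esub> v = \<phi> s"
    unfolding mem_eta_iff by blast+
  have "\<phi> (a \<oplus> b) \<otimes>\<^bsub>Q\<^esub> v \<in> \<phi> ` carrier R" if v: "v \<in> A" for v
  proof -
    obtain s t where s: "s \<in> carrier R" "\<phi> a \<otimes>\<^bsub>Q\<^esub> v = \<phi> s" and t: "t \<in> carrier R" "\<phi> b \<otimes>\<^bsub>Q\<^esub> v = \<phi> t"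
      using a[OF v] b[OF v] by blast
    have "\<phi> (a \<oplus> b) \<otimes>\<^bsub>Q\<^esub> v = \<phi> (s \<oplus> t)"
      using c s t As(1)[OF v] by (simp add: embed_add embed_closed Q.l_distr)
    then show ?thesis using s(1) t(1) by auto
  qed
  then show "a \<oplus> b \<in> eta R A" using c by (simp add: mem_eta_iff)
next
  note As = birationalD[OF A]
  fix a r assume "a \<in> eta R A" and r: "r \<in> carrier R"
  then have c: "a \<in> carrier R" and a: "\<And>v. v \<in> A \<Longrightarrow> \<exists>s\<in>carrier R. \<phi> a \<otimes>\<^bsub>Q\<^esub> v = \<phi> s"
    unfolding mem_eta_iff by blast+
  have "\<phi> (r \<otimes> a) \<otimes>\<^bsub>Q\<^esub> v \<in> \<phi> ` carrier R" if v: "v \<in> A" for v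
  proof -
    obtain s where s: "s \<in> carrier R" "\<phi> a \<otimes>\<^bsub>Q\<^esub> v = \<phi> s" using a[OF v] by blast
    have "\<phi> (r \<otimes> a) \<otimes>\<^bsub>Q\<^esub> v = \<phi> (r \<otimes> s)"
      using c r s As(1)[OF v] by (simp add: embed_mult embed_closed Q.m_assoc)
    then show ?thesis using s(1) r by auto
  qed
  then show "r \<otimes> a \<in> eta R A" using c r by (simp add: mem_eta_iff)
qed

lemma eta_regular_trace:
  assumes A: "A \<in> birational_extensions R"
  shows "eta R A \<in> regular_trace_ideals R"
proof -
  note As = birationalD[OF A]
  note Es = ideal_simps[OF ideal_eta[OF A]]
  obtain x where x: "x \<in> W" "\<And>v. v \<in> A \<Longrightarrow> \<phi> x \<otimes>\<^bsub>Q\<^esub> v \<in> \<phi> ` carrier R"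
    using A unfolding birational_extensions_def by blast
  then have xE: "x \<in> eta R A" using Wc(1) by (simp add: mem_eta_iff)
  have "trace_ideal (eta R A) R"
  proof (rule trace_ideal_of_multipliers[OF ideal_eta[OF A] xE x(1)])
    fix q b assume q: "q \<in> carrier Q" and qR: "\<And>b. b \<in> eta R A \<Longrightarrow> q \<otimes>\<^bsub>Q\<^esub> \<phi> b \<in> \<phi> ` carrier R"
      and b: "b \<in> eta R A"
    obtain s where s: "s \<in> carrier R" "q \<otimes>\<^bsub>Q\<^esub> \<phi> b = \<phi> s" using qR[OF b] by blast
    have "\<phi> s \<otimes>\<^bsub>Q\<^esub> v \<in> \<phi> ` carrier R" if v: "v \<in> A" for v
    proof -
      obtain b' where b': "b' \<in> eta R A" "\<phi> b \<otimes>\<^bsub>Q\<^esub> v = \<phi> b'" using eta_absorbs[OF A b v] .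
      have "\<phi> s \<otimes>\<^bsub>Q\<^esub> v = q \<otimes>\<^bsub>Q\<^esub> \<phi> b'"
        unfolding s(2)[symmetric] b'(2)[symmetric]
        using q embed_closed[OF Es(1)[OF b]] As(1)[OF v] by (simp add: Q.m_assoc)
      then show ?thesis using qR[OF b'(1)] by simp
    qed
    then have "s \<in> eta R A" using s(1) by (simp add: mem_eta_iff)
    then show "q \<otimes>\<^bsub>Q\<^esub> \<phi> b \<in> \<phi> ` eta R A" using s(2) by blast
  qed
  then show ?thesis unfolding regular_trace_ideals_def using xE x(1) by blast
qed

context
  assumes double: "\<And>x J. x \<in> W \<Longrightarrow> ideal J R \<Longrightarrow> x \<in> J \<Longrightarrow>
    ideal_quotient R (PIdl x) (ideal_quotient R (PIdl x) J) = J"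
begin

text \<open>
  For a nonzerodivisor \<open>x \<in> I\<close> one has \<open>R : I = x\<^sup>-\<^sup>1 (x R : I)\<close>, so the hypothesis says that
  \<open>R : (R : I) = I\<close>; and \<open>R : I = I : I\<close> for a trace ideal.
\<close>

lemma eta_rho:
  assumes "I \<in> regular_trace_ideals R"
  shows "eta R (rho R I) = I"
proof
  obtain x where x: "x \<in> I" "x \<in> W" and tr: "trace_ideal I R"
    using assms unfolding regular_trace_ideals_def by blast
  have I: "ideal I R" using ideal_trace_ideal[OF R tr] .
  note Is = ideal_simps[OF I]
  note xc = Is(1)[OF x(1)]
  show "I \<subseteq> eta R (rho R I)"
  proof
    fix b assume b: "b \<in> I"
    have "\<phi> b \<otimes>\<^bsub>Q\<^esub> q \<in> \<phi> ` carrier R" if q: "q \<in> rho R I" for q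
    proof -
      have "q \<in> carrier Q" "q \<otimes>\<^bsub>Q\<^esub> \<phi> b \<in> \<phi> ` I" using q b by (auto simp: mem_rho_iff)
      then show ?thesis using Q.m_comm[OF embed_closed[OF Is(1)[OF b]]] Is(1) by auto
    qed
    then show "b \<in> eta R (rho R I)" using Is(1)[OF b] by (simp add: mem_eta_iff)
  qed
  show "eta R (rho R I) \<subseteq> I"
  proof
    fix r assume "r \<in> eta R (rho R I)"
    then have r: "r \<in> carrier R" and rq: "\<And>q. q \<in> rho R I \<Longrightarrow> \<phi> r \<otimes>\<^bsub>Q\<^esub> q \<in> \<phi> ` carrier R"
      by (auto simp: mem_eta_iff)
    have "r \<otimes> s \<in> PIdl x" if "s \<in> ideal_quotient R (PIdl x) I" for s
    proof -
      have s: "s \<in> carrier R" "\<And>b. b \<in> I \<Longrightarrow> \<exists>t\<in>carrier R. s \<otimes> b = x \<otimes> t"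
        using that mem_PIdl_iff[OF xc] by (auto simp: ideal_quotient_def)
      obtain q where q: "q \<in> carrier Q" "\<phi> x \<otimes>\<^bsub>Q\<^esub> q = \<phi> s" using embed_divide[OF x(2) s(1)] .
      have qR: "q \<otimes>\<^bsub>Q\<^esub> \<phi> b \<in> \<phi> ` carrier R" if b: "b \<in> I" for b
      proof -
        obtain t where t: "t \<in> carrier R" "s \<otimes> b = x \<otimes> t" using s(2)[OF b] by blast
        note bc = Is(1)[OF b]
        have "q \<otimes>\<^bsub>Q\<^esub> \<phi> b = \<phi> t"
        proof (rule embed_cancel[OF x(2)])
          have "\<phi> x \<otimes>\<^bsub>Q\<^esub> (q \<otimes>\<^bsub>Q\<^esub> \<phi> b) = \<phi> s \<otimes>\<^bsub>Q\<^esub> \<phi> b"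
            unfolding q(2)[symmetric] using q(1) embed_closed[OF bc] embed_closed[OF xc] by (simp add: Q.m_assoc)
          also have "\<dots> = \<phi> x \<otimes>\<^bsub>Q\<^esub> \<phi> t"
            using embed_mult[OF s(1) bc] embed_mult[OF xc t(1)] t(2) by simp
          finally show "\<phi> x \<otimes>\<^bsub>Q\<^esub> (q \<otimes>\<^bsub>Q\<^esub> \<phi> b) = \<phi> x \<otimes>\<^bsub>Q\<^esub> \<phi> t" .
        qed (use q(1) embed_closed bc t(1) in auto)
        then show ?thesis using t(1) by blast
      qed
      have "q \<in> rho R I"
        unfolding mem_rho_iff using q(1) trace_ideal_multiplier[OF tr q(1) qR] by blast
      then obtain t where t: "t \<in> carrier R" "\<phi> r \<otimes>\<^bsub>Q\<^esub> q = \<phi> t" using rq by blast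
      have "\<phi> (r \<otimes> s) = \<phi> r \<otimes>\<^bsub>Q\<^esub> (\<phi> x \<otimes>\<^bsub>Q\<^esub> q)" unfolding q(2) by (rule embed_mult[OF r s(1)])
      also have "\<dots> = \<phi> x \<otimes>\<^bsub>Q\<^esub> (\<phi> r \<otimes>\<^bsub>Q\<^esub> q)"
        using q(1) embed_closed[OF r] embed_closed[OF xc] by (simp add: Q.m_lcomm)
      also have "\<dots> = \<phi> (x \<otimes> t)" unfolding t(2) using embed_mult[OF xc t(1)] by simp
      finally have "r \<otimes> s = x \<otimes> t" using embed_eq r s(1) xc t(1) by simp
      then show ?thesis unfolding mem_PIdl_iff[OF xc] using t(1) by blast
    qed
    then have "r \<in> ideal_quotient R (PIdl x) (ideal_quotient R (PIdl x) I)"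
      using r by (simp add: ideal_quotient_def[of R _ "ideal_quotient R (PIdl x) I"])
    then show "r \<in> I" unfolding double[OF x(2) I x(1)] .
  qed
qed

text \<open>
  Let \<open>a\<close> be a nonzerodivisor with \<open>a A \<subseteq> R\<close>.  The ideal \<open>J = a A\<close> of \<open>R\<close> satisfies \<open>R : A = a R : J\<close>, so an
  element \<open>q\<close> of \<open>(R : A) : (R : A)\<close> has \<open>a q \<in> a R : (a R : J) = J\<close>.
\<close>

lemma rho_eta:
  assumes A: "A \<in> birational_extensions R"
  shows "rho R (eta R A) = A"
proof
  note As = birationalD[OF A]
  note Es = ideal_simps[OF ideal_eta[OF A]]
  show "A \<subseteq> rho R (eta R A)"
  proof
    fix v assume v: "v \<in> A"
    have "v \<otimes>\<^bsub>Q\<^esub> \<phi> b \<in> \<phi> ` eta R A" if b: "b \<in> eta R A" for b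
    proof -
      obtain s where "s \<in> eta R A" "\<phi> b \<otimes>\<^bsub>Q\<^esub> v = \<phi> s" using eta_absorbs[OF A b v] .
      then show ?thesis using Q.m_comm[OF As(1)[OF v] embed_closed[OF Es(1)[OF b]]] by simp
    qed
    then show "v \<in> rho R (eta R A)" using As(1)[OF v] by (simp add: mem_rho_iff)
  qed
  show "rho R (eta R A) \<subseteq> A"
  proof
    fix q assume "q \<in> rho R (eta R A)"
    then have q: "q \<in> carrier Q" and qE: "\<And>b. b \<in> eta R A \<Longrightarrow> q \<otimes>\<^bsub>Q\<^esub> \<phi> b \<in> \<phi> ` eta R A"
      by (auto simp: mem_rho_iff)
    obtain a where a: "a \<in> W" "\<And>v. v \<in> A \<Longrightarrow> \<phi> a \<otimes>\<^bsub>Q\<^esub> v \<in> \<phi> ` carrier R"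
      using A unfolding birational_extensions_def by blast
    note ac = Wc(1)[OF a(1)]
    have aE: "a \<in> eta R A" using a(2) ac by (simp add: mem_eta_iff)
    define J where "J = {r \<in> carrier R. \<exists>v\<in>A. \<phi> r = \<phi> a \<otimes>\<^bsub>Q\<^esub> v}"
    have J: "ideal J R"
    proof (rule ideal_of_closed)
      show "J \<subseteq> carrier R" by (auto simp: J_def)
      have "\<phi> \<zero> \<in> A" by (rule As(5)) simp
      moreover have "\<phi> \<zero> = \<phi> a \<otimes>\<^bsub>Q\<^esub> \<phi> \<zero>" using embed_closed[OF ac] by (simp add: embed_zero)
      ultimately show "\<zero> \<in> J" by (auto simp: J_def)
    next
      fix r s assume "r \<in> J" "s \<in> J"
      then obtain v w where r: "r \<in> carrier R" "v \<in> A" "\<phi> r = \<phi> a \<otimes>\<^bsub>Q\<^esub> v"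
        and s: "s \<in> carrier R" "w \<in> A" "\<phi> s = \<phi> a \<otimes>\<^bsub>Q\<^esub> w" by (auto simp: J_def)
      have "\<phi> (r \<oplus> s) = \<phi> a \<otimes>\<^bsub>Q\<^esub> (v \<oplus>\<^bsub>Q\<^esub> w)"
        using r s As(1) embed_closed[OF ac] by (simp add: embed_add Q.r_distr)
      then show "r \<oplus> s \<in> J" using As(4)[OF r(2) s(2)] r(1) s(1) by (auto simp: J_def)
    next
      fix r s assume "r \<in> J" and s: "s \<in> carrier R"
      then obtain v where r: "r \<in> carrier R" "v \<in> A" "\<phi> r = \<phi> a \<otimes>\<^bsub>Q\<^esub> v" by (auto simp: J_def)
      have "\<phi> (s \<otimes> r) = \<phi> a \<otimes>\<^bsub>Q\<^esub> (\<phi> s \<otimes>\<^bsub>Q\<^esub> v)"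
        using r s As(1) embed_closed[OF ac] embed_closed[OF s] by (simp add: embed_mult Q.m_lcomm)
      then show "s \<otimes> r \<in> J" using As(3)[OF As(5)[OF s] r(2)] r(1) s by (auto simp: J_def)
    qed
    have "\<phi> a = \<phi> a \<otimes>\<^bsub>Q\<^esub> \<one>\<^bsub>Q\<^esub>" using embed_closed[OF ac] by simp
    then have aJ: "a \<in> J" using ac As(2) by (auto simp: J_def)
    obtain r where r: "r \<in> eta R A" "q \<otimes>\<^bsub>Q\<^esub> \<phi> a = \<phi> r" using qE[OF aE] by blast
    note rc = Es(1)[OF r(1)]
    have "r \<otimes> s \<in> PIdl a" if "s \<in> ideal_quotient R (PIdl a) J" for s
    proof -
      have s: "s \<in> carrier R" "\<And>j. j \<in> J \<Longrightarrow> \<exists>t\<in>carrier R. s \<otimes> j = a \<otimes> t"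
        using that mem_PIdl_iff[OF ac] by (auto simp: ideal_quotient_def)
      have "\<phi> s \<otimes>\<^bsub>Q\<^esub> v \<in> \<phi> ` carrier R" if v: "v \<in> A" for v
      proof -
        obtain j where j: "j \<in> carrier R" "\<phi> a \<otimes>\<^bsub>Q\<^esub> v = \<phi> j" using a(2)[OF v] by blast
        then have "j \<in> J" using v by (auto simp: J_def)
        then obtain t where t: "t \<in> carrier R" "s \<otimes> j = a \<otimes> t" using s(2) by blast
        have "\<phi> s \<otimes>\<^bsub>Q\<^esub> v = \<phi> t"
        proof (rule embed_cancel[OF a(1)])
          have "\<phi> a \<otimes>\<^bsub>Q\<^esub> (\<phi> s \<otimes>\<^bsub>Q\<^esub> v) = \<phi> s \<otimes>\<^bsub>Q\<^esub> \<phi> j"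
            unfolding j(2)[symmetric] using embed_closed[OF ac] embed_closed[OF s(1)] As(1)[OF v]
            by (simp add: Q.m_lcomm)
          also have "\<dots> = \<phi> a \<otimes>\<^bsub>Q\<^esub> \<phi> t"
            using embed_mult[OF s(1) j(1)] embed_mult[OF ac t(1)] t(2) by simp
          finally show "\<phi> a \<otimes>\<^bsub>Q\<^esub> (\<phi> s \<otimes>\<^bsub>Q\<^esub> v) = \<phi> a \<otimes>\<^bsub>Q\<^esub> \<phi> t" .
        qed (use embed_closed s(1) t(1) As(1)[OF v] in auto)
        then show ?thesis using t(1) by blast
      qed
      then have "s \<in> eta R A" using s(1) by (simp add: mem_eta_iff)
      then obtain t where t: "t \<in> carrier R" "q \<otimes>\<^bsub>Q\<^esub> \<phi> s = \<phi> t" using qE Es(1) by blast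
      have "\<phi> (r \<otimes> s) = q \<otimes>\<^bsub>Q\<^esub> \<phi> a \<otimes>\<^bsub>Q\<^esub> \<phi> s" unfolding r(2) by (rule embed_mult[OF rc s(1)])
      also have "\<dots> = \<phi> a \<otimes>\<^bsub>Q\<^esub> (q \<otimes>\<^bsub>Q\<^esub> \<phi> s)"
        using q embed_closed[OF ac] embed_closed[OF s(1)] by (simp add: Q.m_ac)
      also have "\<dots> = \<phi> (a \<otimes> t)" unfolding t(2) using embed_mult[OF ac t(1)] by simp
      finally have "r \<otimes> s = a \<otimes> t" using embed_eq rc s(1) ac t(1) by simp
      then show ?thesis unfolding mem_PIdl_iff[OF ac] using t(1) by blast
    qed
    then have "r \<in> ideal_quotient R (PIdl a) (ideal_quotient R (PIdl a) J)"
      using rc by (simp add: ideal_quotient_def[of R _ "ideal_quotient R (PIdl a) J"])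
    then have "r \<in> J" unfolding double[OF a(1) J aJ] .
    then obtain v where v: "v \<in> A" "\<phi> r = \<phi> a \<otimes>\<^bsub>Q\<^esub> v" by (auto simp: J_def)
    have "\<phi> a \<otimes>\<^bsub>Q\<^esub> q = \<phi> a \<otimes>\<^bsub>Q\<^esub> v"
      using r(2) v(2) Q.m_comm[OF q embed_closed[OF ac]] by simp
    then show "q \<in> A" using embed_cancel[OF a(1) q As(1)[OF v(1)]] v(1) by simp
  qed
qed

end

end

theorem corollary2p8:
  fixes R :: "('a, 'x) ring_scheme"
  assumes "gorenstein_ring TYPE('e) R"
    and "krull_dimension R = 1"
  shows "rho R \<in> regular_trace_ideals R \<rightarrow> birational_extensions R
    \<and> eta R \<in> birational_extensions R \<rightarrow> regular_trace_ideals R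
    \<and> (\<forall>I \<in> regular_trace_ideals R. eta R (rho R I) = I)
    \<and> (\<forall>A \<in> birational_extensions R. rho R (eta R A) = A)
    \<and> bij_betw (rho R) (regular_trace_ideals R) (birational_extensions R)"
proof -
  have R: "cring R" using assms(1) by (simp add: gorenstein_ring_def)
  have dim: "krull_dimension R \<le> 1" using assms(2) by simp
  note double = double_ideal_quotient_gorenstein[OF assms(1) dim]
  have rho: "rho R \<in> regular_trace_ideals R \<rightarrow> birational_extensions R"
    using rho_birational[OF R] by blast
  have eta: "eta R \<in> birational_extensions R \<rightarrow> regular_trace_ideals R"
    using eta_regular_trace[OF R] by blast
  have er: "\<forall>I \<in> regular_trace_ideals R. eta R (rho R I) = I"
    using eta_rho[OF R double] by blast
  have re: "\<forall>A \<in> birational_extensions R. rho R (eta R A) = A"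
    using rho_eta[OF R double] by blast
  have "bij_betw (rho R) (regular_trace_ideals R) (birational_extensions R)"
    by (rule bij_betw_byWitness[OF er re]) (use rho eta in blast)+
  with rho eta er re show ?thesis by blast
qed

end
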